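(* Let $\xi_0,\xi_1,\xi_2,\dots$ be a $\psi$-mixing stationary process, let $\ell\ge 1$, and let $q_1,\dots,q_\ell$ be strictly increasing functions taking integer values on integers such that $$0\le q_1(n)<q_2(n)<\dots<q_\ell(n)\ \text{ for all } n\ge 0,\qquad q(n)=\min_{k\ge n}\ \min_{1\le i\le \ell-1}\bigl(q_{i+1}(k)-q_i(k)\bigr)\to\infty\ \text{ as } n\to\infty .$$ Let $\Gamma_N,\Delta_N$, $N=1,2,\dots$, be a sequence of pairs of disjoint Borel subsets of $\mathbb{R}$ such that $$Q(\Gamma_N),\,Q(\Delta_N)\to0\ \text{ as } N\to\infty\quad\text{and}\quad 0<C^{-1}\le\frac{Q(\Gamma_N)}{Q(\Delta_N)}\le C<\infty$$ for some constant $C$. Set $$X^{(N)}_{n,0}=\prod_{i=1}^\ell\mathbb{I}_{\Gamma_N}(\xi_{q_i(n)}),\quad X^{(N)}_{n,1}=\prod_{i=1}^\ell\mathbb{I}_{\Delta_N}(\xi_{q_i(n)}),\quad \tau_N=\min\{n\ge0: X^{(N)}_{n,0}=1\},\quad S^{(N)}_M=\sum_{n=0}^{M-1}X^{(N)}_{n,1}.$$ Then $$d_{TV}\bigl(\mathcal{L}(S^{(N)}_{\tau_N}),\mathrm{Geo}(\rho_N)\bigr)\to0\ \text{ as } N\to\infty,\qquad \rho_N=\frac{Q(\Gamma_N)^\ell}{Q(\Delta_N)^\ell+Q(\Gamma_N)^\ell}.$$ In particular, if $\lim_{N\to\infty}\frac{Q(\Delta_N)}{Q(\Gamma_N)}=\lambda$,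 then the distribution of $S^{(N)}_{\tau_N}$ converges in total variation as $N\to\infty$ to the geometric distribution $\mathrm{Geo}\bigl((1+\lambda^\ell)^{-1}\bigr)$.
   Context: The process $\xi_0,\xi_1,\dots$ is a stationary sequence of real random variables on a complete probability space $(\Omega,\mathcal{F},P)$. $Q$ denotes the distribution of $\xi_0$, i.e. $Q(\Gamma)=P\{\xi_0\in\Gamma\}$ for Borel $\Gamma\subset\mathbb{R}$. $\mathbb{I}_\Gamma$ is the indicator function of $\Gamma$. For $m\le n$ let $\mathcal{F}_{mn}=\sigma(\xi_m,\xi_{m+1},\dots,\xi_n)$ (and $\mathcal{F}_{m,\infty}=\sigma(\xi_m,\xi_{m+1},\dots)$). For $\sigma$-algebras $\mathcal{G},\mathcal{H}\subset\mathcal{F}$, $$\psi(\mathcal{G},\mathcal{H})=\sup_{\Gamma\in\mathcal{G},\,\Delta\in\mathcal{H}}\Bigl\{\Bigl|\frac{P(\Gamma\cap\Delta)}{P(\Gamma)P(\Delta)}-1\Bigr|:\ P(\Gamma)P(\Delta)\neq0\Bigr\},\qquad \psi(n)=\sup_{m\ge0}\psi(\mathcal{F}_{0,m},\mathcal{F}_{m+n,\infty}).$$ The process is called $\psi$-mixing if $\psi(1)<\infty$ and $\psi(n)\to0$ as $n\to\infty$. Conventions: $\tau_N=\infty$ if the set defining it is empty; $S^{(N)}_0=0$. If $\ell=1$, the minimum over the empty set defining $q(n)$ is $+\infty$ (so the condition $q(n)\to\infty$ is void). $\mathcal{L}(Y)$ is the distribution of $Y$, and $d_{TV}(\mathcal{L}(Y),\mathcal{L}(Z))=\sup_G|\mathcal{L}(Y)(G)-\mathcal{L}(Z)(G)|$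 with the supremum over all Borel sets $G$. For $\rho\in(0,1)$, $\mathrm{Geo}(\rho)$ is the distribution on $\{0,1,2,\dots\}$ with $\mathrm{Geo}(\rho)\{k\}=\rho(1-\rho)^k$. *)

theory Defs
  imports "HOL-Probability.Probability"
begin

section \<open>Stationary \<open>\<psi>\<close>-mixing processes\<close>

definition stationary_process :: "'a measure \<Rightarrow> (nat \<Rightarrow> 'a \<Rightarrow> real) \<Rightarrow> bool" where
  "stationary_process M \<xi> \<longleftrightarrow>
     (\<forall>n. \<xi> n \<in> borel_measurable M) \<and>
     (\<forall>k. distr M (Pi\<^sub>M UNIV (\<lambda>_. borel)) (\<lambda>\<omega> n. \<xi> (n + k) \<omega>)
        = distr M (Pi\<^sub>M UNIV (\<lambda>_. borel)) (\<lambda>\<omega> n. \<xi> n \<omega>))"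

definition process_sigma :: "'a measure \<Rightarrow> (nat \<Rightarrow> 'a \<Rightarrow> real) \<Rightarrow> nat set \<Rightarrow> 'a set set" where
  "process_sigma M \<xi> I =
     sigma_sets (space M) {\<xi> i -` B \<inter> space M | i B. i \<in> I \<and> B \<in> sets borel}"

text \<open>The dependence coefficients may be infinite, hence the values in \<^typ>\<open>ennreal\<close>.\<close>

definition psi_dep :: "'a measure \<Rightarrow> 'a set set \<Rightarrow> 'a set set \<Rightarrow> ennreal" where
  "psi_dep M \<G> \<H> =
     (SUP (A, B) \<in> {(A, B). A \<in> \<G> \<and> B \<in> \<H> \<and> measure M A * measure M B \<noteq> 0}.
        ennreal \<bar>measure M (A \<inter> B) / (measure M A * measure M B) - 1\<bar>)"

definition psi_coeff :: "'a measure \<Rightarrow> (nat \<Rightarrow> 'a \<Rightarrow> real) \<Rightarrow> nat \<Rightarrow> ennreal" where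
  "psi_coeff M \<xi> n =
     (SUP m. psi_dep M (process_sigma M \<xi> {0..m}) (process_sigma M \<xi> {m + n..}))"

definition psi_mixing :: "'a measure \<Rightarrow> (nat \<Rightarrow> 'a \<Rightarrow> real) \<Rightarrow> bool" where
  "psi_mixing M \<xi> \<longleftrightarrow> psi_coeff M \<xi> 1 < \<infinity> \<and> psi_coeff M \<xi> \<longlonglongrightarrow> 0"

section \<open>Nonconventional arrays and counting up to a hazard\<close>

text \<open>
  For \<open>l = 1\<close> the inner infimum is over the empty set, so the value is \<open>\<infinity>\<close>.
  The truncated subtraction is only used for sequences with \<open>q i k < q (i + 1) k\<close>.
\<close>

definition min_gap :: "nat \<Rightarrow> (nat \<Rightarrow> nat \<Rightarrow> nat) \<Rightarrow> nat \<Rightarrow> enat" where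
  "min_gap l q n = (INF k \<in> {n..}. INF i \<in> {1..l - 1}. enat (q (i + 1) k - q i k))"

definition joint_visit ::
  "(nat \<Rightarrow> 'a \<Rightarrow> real) \<Rightarrow> nat \<Rightarrow> (nat \<Rightarrow> nat \<Rightarrow> nat) \<Rightarrow> real set \<Rightarrow> nat \<Rightarrow> 'a \<Rightarrow> real" where
  "joint_visit \<xi> l q A n \<omega> = (\<Prod>i = 1..l. indicator A (\<xi> (q i n) \<omega>))"

text \<open>The infimum in \<^typ>\<open>enat\<close> is a minimum if the set is nonempty, and \<open>\<infinity>\<close> otherwise.\<close>

definition hazard_time :: "(nat \<Rightarrow> 'a \<Rightarrow> real) \<Rightarrow> 'a \<Rightarrow> enat" where
  "hazard_time X \<omega> = (INF n \<in> {n. X n \<omega> = 1}. enat n)"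

text \<open>
  Partial sums, extended to an infinite upper summation bound by the series (possibly \<open>\<infinity>\<close>), so
  that the sum up to \<^const>\<open>hazard_time\<close> is defined everywhere.
\<close>

definition partial_sum :: "(nat \<Rightarrow> 'a \<Rightarrow> real) \<Rightarrow> enat \<Rightarrow> 'a \<Rightarrow> ereal" where
  "partial_sum X m \<omega> =
     (case m of enat k \<Rightarrow> ereal (\<Sum>n<k. X n \<omega>) | \<infinity> \<Rightarrow> (\<Sum>n. ereal (X n \<omega>)))"

section \<open>Total variation distance and the geometric distribution\<close>

text \<open>To be used for probability measures on the same \<open>\<sigma>\<close>-algebra.\<close>

definition tv_dist :: "'b measure \<Rightarrow> 'b measure \<Rightarrow> real" where
  "tv_dist \<mu> \<nu> = (SUP G \<in> sets \<mu>. \<bar>measure \<mu> G - measure \<nu> G\<bar>)"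

text \<open>
  \<^const>\<open>geometric_pmf\<close> gives \<open>k = 0, 1, 2, \<dots>\<close> the mass \<open>\<rho> (1 - \<rho>)^k\<close>; it is viewed as a Borel
  measure on the extended real line, where the values of \<^const>\<open>partial_sum\<close> lie.
\<close>

definition Geo :: "real \<Rightarrow> ereal measure" where
  "Geo \<rho> = distr (measure_pmf (geometric_pmf \<rho>)) borel (\<lambda>k. ereal (real k))"

end

theory Submission
  imports Defs
begin

text \<open>
  Call time \<open>n\<close> a hazard if all sites \<open>q i n\<close> visit \<open>\<Gamma>\<close>, and a hit if they all visit \<open>\<Delta>\<close>, and put
  \<open>p = Q \<Gamma> ^ l\<close> and \<open>r = Q \<Delta> ^ l\<close>.  If the mark at time \<open>n\<close> were independent of the earlier marks and a
  hazard with probability \<open>p\<close> and a hit with probability \<open>r\<close>, the probability \<open>u k n\<close> of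
  no hazard and exactly \<open>k\<close> hits before time \<open>n\<close> would satisfy
  \<open>u k (n + 1) - u k n = - (p + r) * u k n + r * u (k - 1) n\<close>.  Summing over all \<open>n\<close> gives
  \<open>(p + r) * U 0 = 1\<close> and \<open>(p + r) * U k = r * U (k - 1)\<close> for the total sums \<open>U k\<close>, so that the first
  hazard is preceded by exactly \<open>k\<close> hits with probability \<open>p * U k = \<rho> * (1 - \<rho>) ^ k\<close>.

  This argument is robust.  The sum over \<open>n\<close> telescopes, so an error in the independence of the mark at
  time \<open>n\<close> from the past enters only once.  On a horizon of \<open>K / p\<close> steps, errors that are
  small compared with \<open>p\<close> therefore have a small total, and the same summation shows that survival beyond this
  horizon has probability about \<open>1 / K\<close> at most (\<open>prob_survival_bound\<close>, \<open>geometric_count_bound\<close>).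

  It remains to see that the mark at time \<open>n\<close> is almost independent of the earlier marks, with an error small
  compared with \<open>p\<close> (\<open>history_decoupling\<close>).  Only boundedly many earlier times have a site within
  distance \<open>L\<close> of a site of time \<open>n\<close>, and both times carrying a mark involves at least \<open>l + 1\<close> distinct
  sites, an event much rarer than a single mark; so these times can be erased from the past.
  What remains of the past lives at distance at least \<open>L\<close> from each site of time \<open>n\<close>, though on both
  sides of it, and \<open>\<psi>\<close>-mixing, applied to cells of words of symbols, decouples the sites one after the other with
  a relative error (\<open>site_decoupling\<close>, \<open>sites_decoupling\<close>).  Since the error is relative, it stays
  small compared with \<open>p\<close>.  The first few times, at which the sites of one time are not yet far apart, are
  negligible because the sets are small.

  Thus each atom of the law of the count approaches that of the geometric law.  The parameters \<open>\<rho>\<close> stay away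
  from 0 because the two frequencies are comparable, and this tightness turns convergence of the atoms into
  convergence in total variation (\<open>tv_dist_Geo_tendsto\<close>).
\<close>

section \<open>Words of symbols under \<open>\<psi>\<close>-mixing\<close>

datatype symbol = Hazard | Hit | Blank

lemma UNIV_symbol: "UNIV = {Hazard, Hit, Blank}"
  using symbol.exhaust by auto

instance symbol :: finite
  by standard (simp add: UNIV_symbol)

text \<open>
  Sites outside \<open>J\<close> read \<^const>\<open>Blank\<close>, so forgetting what happens at some sites just means
  shrinking \<open>J\<close>, and a word over a finite \<open>J\<close> takes only finitely many values.
\<close>

definition word :: "(nat \<Rightarrow> 'a \<Rightarrow> symbol) \<Rightarrow> nat set \<Rightarrow> 'a \<Rightarrow> nat \<Rightarrow> symbol" where
  "word w J \<omega> t = (if t \<in> J then w t \<omega> else Blank)"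

lemma abs_diff_scaled:
  fixes k :: real
  shows "0 \<le> k \<Longrightarrow> \<bar>x - y\<bar> \<le> d \<Longrightarrow> \<bar>k * x - k * y\<bar> \<le> k * d"
  by (simp add: abs_mult mult_left_mono flip: right_diff_distrib)

lemma process_sigma_mono: "I \<subseteq> J \<Longrightarrow> process_sigma M \<xi> I \<subseteq> process_sigma M \<xi> J"
  unfolding process_sigma_def by (rule sigma_sets_mono') auto

lemma sigma_algebra_process_sigma: "sigma_algebra (space M) (process_sigma M \<xi> I)"
  unfolding process_sigma_def by (rule sigma_algebra_sigma_sets) auto

lemma process_sigma_subset_sets:
  assumes "\<And>n. \<xi> n \<in> borel_measurable M"
  shows "process_sigma M \<xi> I \<subseteq> sets M"
  unfolding process_sigma_def using assms
  by (intro sets.sigma_sets_subset) (auto intro: measurable_sets)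

text \<open>
  Multiplying the quotient in \<^const>\<open>psi_dep\<close> out gives a bound that also covers null events, for
  which both sides vanish.
\<close>

lemma psi_coeff_bound:
  assumes "prob_space M" and \<xi>: "\<And>n. \<xi> n \<in> borel_measurable M"
    and e: "psi_coeff M \<xi> n \<le> ennreal e" "0 \<le> e"
    and A: "A \<in> process_sigma M \<xi> {0..m}" and B: "B \<in> process_sigma M \<xi> {m + n..}"
  shows "\<bar>measure M (A \<inter> B) - measure M A * measure M B\<bar> \<le> e * (measure M A * measure M B)"
proof -
  interpret prob_space M by fact
  have sets: "A \<in> sets M" "B \<in> sets M"
    using A B process_sigma_subset_sets[of \<xi> M, OF \<xi>] by blast+
  show ?thesis
  proof (cases "measure M A * measure M B = 0")
    case True
    have "measure M (A \<inter> B) \<le> measure M A" "measure M (A \<inter> B) \<le> measure M B"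
      using sets by (auto intro: finite_measure_mono)
    with True have "measure M (A \<inter> B) = 0"
      using measure_nonneg[of M "A \<inter> B"] by (auto intro: antisym)
    with True show ?thesis by (metis abs_zero diff_zero mult_zero_right order_refl)
  next
    case False
    let ?y = "measure M A * measure M B"
    have "ennreal \<bar>measure M (A \<inter> B) / ?y - 1\<bar>
      \<le> psi_dep M (process_sigma M \<xi> {0..m}) (process_sigma M \<xi> {m + n..})"
      unfolding psi_dep_def by (rule SUP_upper2[of "(A, B)"]) (use A B False in auto)
    also have "\<dots> \<le> psi_coeff M \<xi> n"
      unfolding psi_coeff_def by (rule SUP_upper2[of m]) auto
    also note e(1)
    finally have le: "\<bar>measure M (A \<inter> B) / ?y - 1\<bar> \<le> e"
      using e(2) by simp
    have y: "?y > 0" using False by (simp add: less_le)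
    have "measure M (A \<inter> B) - ?y = (measure M (A \<inter> B) / ?y - 1) * ?y"
      using False by (simp add: field_simps)
    then have "\<bar>measure M (A \<inter> B) - ?y\<bar> = \<bar>measure M (A \<inter> B) / ?y - 1\<bar> * ?y"
      using y by (simp add: abs_mult)
    with le y show ?thesis by (metis mult_right_mono less_imp_le)
  qed
qed

text \<open>
  Only the membership of \<open>\<xi> n\<close> in two sets matters, so the process is coded by a function \<open>h\<close> into
  three symbols.
\<close>

locale symbolic_process = prob_space M for M :: "'a measure" +
  fixes \<xi> :: "nat \<Rightarrow> 'a \<Rightarrow> real" and h :: "real \<Rightarrow> symbol"
  assumes measurable_process: "\<And>n. \<xi> n \<in> borel_measurable M"
    and stationary_symbols: "\<And>s c. prob {\<omega> \<in> space M. h (\<xi> s \<omega>) = c}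
      = prob {\<omega> \<in> space M. h (\<xi> 0 \<omega>) = c}"
    and measurable_symbol: "\<And>c. h -` {c} \<in> sets borel"
begin

definition w :: "nat \<Rightarrow> 'a \<Rightarrow> symbol" where "w s \<omega> = h (\<xi> s \<omega>)"

definition freq :: "symbol \<Rightarrow> real" where "freq c = prob {\<omega> \<in> space M. w 0 \<omega> = c}"

lemma freq_nonneg: "0 \<le> freq c" and freq_le_1: "freq c \<le> 1"
  by (auto simp: freq_def)

lemma prob_symbol: "prob {\<omega> \<in> space M. w s \<omega> = c} = freq c"
  using stationary_symbols by (simp add: freq_def w_def)

lemma symbol_event: "s \<in> I \<Longrightarrow> {\<omega> \<in> space M. w s \<omega> = c} \<in> process_sigma M \<xi> I"
  unfolding process_sigma_def w_def
  by (rule sigma_sets.Basic, rule CollectI, rule exI[of _ s], rule exI[of _ "h -` {c}"])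
     (use measurable_symbol[of c] in auto)

lemma word_event:
  assumes "finite J" "J \<subseteq> I"
  shows "{\<omega> \<in> space M. \<Phi> (word w J \<omega>)} \<in> process_sigma M \<xi> I"
  using assms
proof (induction J arbitrary: \<Phi> rule: finite_induct)
  case empty
  interpret sigma_algebra "space M" "process_sigma M \<xi> I" by (rule sigma_algebra_process_sigma)
  show ?case by (cases "\<Phi> (\<lambda>t. Blank)") (auto simp: word_def)
next
  case (insert s J)
  interpret S: sigma_algebra "space M" "process_sigma M \<xi> I" by (rule sigma_algebra_process_sigma)
  have word: "word w (insert s J) \<omega> = (word w J \<omega>)(s := w s \<omega>)" for \<omega>
    using insert by (auto simp: word_def fun_eq_iff)
  have "{\<omega> \<in> space M. \<Phi> (word w (insert s J) \<omega>)} =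
    (\<Union>c\<in>UNIV. {\<omega> \<in> space M. w s \<omega> = c} \<inter> {\<omega> \<in> space M. \<Phi> ((word w J \<omega>)(s := c))})"
    by (auto simp: word)
  also have "\<dots> \<in> process_sigma M \<xi> I"
  proof (intro S.finite_UN S.Int)
    fix c
    show "{\<omega> \<in> space M. w s \<omega> = c} \<in> process_sigma M \<xi> I"
      using insert.prems by (intro symbol_event) auto
    show "{\<omega> \<in> space M. \<Phi> ((word w J \<omega>)(s := c))} \<in> process_sigma M \<xi> I"
      using insert.IH[of "\<lambda>v. \<Phi> (v(s := c))"] insert.prems by auto
  qed auto
  finally show ?case .
qed

lemma word_event_sets: "finite J \<Longrightarrow> {\<omega> \<in> space M. \<Phi> (word w J \<omega>)} \<in> events"
  using word_event[of J UNIV] process_sigma_subset_sets[of \<xi> M, OF measurable_process] by blast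

lemma finite_words: "finite J \<Longrightarrow> finite (range (word w J))"
  by (rule finite_subset[OF _ finite_set_of_finite_funs[of J UNIV Blank]])
     (auto simp: word_def)

text \<open>
  The mixing condition speaks of the intersection of one past event and one future event.  An event
  that depends on both sides jointly is a finite disjoint union of such intersections, and estimates
  that are relative to the probability of each cell add up over this union.
\<close>

lemma prob_split_words:
  assumes "finite I" "finite J" "A \<in> events"
  shows "prob (A \<inter> {\<omega> \<in> space M. \<Phi> (word w I \<omega>) (word w J \<omega>)})
    = (\<Sum>(u, v) \<in> {(u, v) \<in> range (word w I) \<times> range (word w J). \<Phi> u v}.
        prob (A \<inter> {\<omega> \<in> space M. word w I \<omega> = u} \<inter> {\<omega> \<in> space M. word w J \<omega> = v}))"
proof -
  let ?R = "{(u, v) \<in> range (word w I) \<times> range (word w J). \<Phi> u v}"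
  let ?E = "\<lambda>(u, v). A \<inter> {\<omega> \<in> space M. word w I \<omega> = u} \<inter> {\<omega> \<in> space M. word w J \<omega> = v}"
  have fin: "finite ?R"
    by (rule finite_subset[of _ "range (word w I) \<times> range (word w J)"])
       (auto simp: finite_words assms)
  have un: "A \<inter> {\<omega> \<in> space M. \<Phi> (word w I \<omega>) (word w J \<omega>)} = (\<Union>x\<in>?R. ?E x)"
    by auto
  have "prob (\<Union>x\<in>?R. ?E x) = (\<Sum>x\<in>?R. prob (?E x))"
  proof (rule finite_measure_finite_Union[OF fin])
    show "?E ` ?R \<subseteq> events"
      using assms word_event_sets[OF assms(1)] word_event_sets[OF assms(2)] by auto
    show "disjoint_family_on ?E ?R"
      by (auto simp: disjoint_family_on_def)
  qed
  then show ?thesis unfolding un by (simp add: case_prod_unfold)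
qed

text \<open>
  If \<open>s < L\<close>, no time lies at distance \<open>L\<close> before \<open>s\<close>; then the past is trivial and independent of everything.
\<close>

lemma past_future_bound:
  assumes psi: "psi_coeff M \<xi> L \<le> ennreal e" "0 \<le> e"
    and A: "A \<in> process_sigma M \<xi> {t. t + L \<le> s}" and B: "B \<in> process_sigma M \<xi> {s..}"
  shows "\<bar>prob (A \<inter> B) - prob A * prob B\<bar> \<le> e * (prob A * prob B)"
proof (cases "L \<le> s")
  case True
  have "{t. t + L \<le> s} = {0..s - L}" using True by auto
  with A B True show ?thesis
    by (intro psi_coeff_bound[OF prob_space_axioms measurable_process psi, where m = "s - L"]) auto
next
  case False
  then have "{t. t + L \<le> s} = {}" by auto
  with A have "A \<in> {{}, space M}"
    by (simp add: process_sigma_def sigma_sets_empty_eq)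
  moreover have "B \<in> events" using B process_sigma_subset_sets[of \<xi> M, OF measurable_process] by blast
  ultimately show ?thesis using psi by (auto simp: prob_space)
qed

text \<open>
  For a past cell \<open>P\<close> and a future cell \<open>F\<close>, the probabilities of \<open>P \<inter> A \<inter> F\<close> and of \<open>P \<inter> F\<close> times
  that of \<open>A\<close> are both compared with the product \<open>z\<close> of the three probabilities.  Two mixing steps lead to
  \<open>P \<inter> A \<inter> F\<close> and one to \<open>P \<inter> F\<close>.  For \<open>e \<le> 1/2\<close> these errors sum up to at most \<open>4 * e * z\<close>, and \<open>z\<close> is at most
  twice the second of the two quantities, which gives the constant 8.
\<close>

lemma site_decoupling:
  fixes c \<Phi>
  assumes psi: "psi_coeff M \<xi> L \<le> ennreal e" and e: "0 \<le> e" "e \<le> 1/2"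
    and J: "finite J" "\<And>t. t \<in> J \<Longrightarrow> t + L \<le> s \<or> s + L \<le> t" and L: "L \<ge> 1"
  defines "A \<equiv> {\<omega> \<in> space M. w s \<omega> = c}" and "E \<equiv> {\<omega> \<in> space M. \<Phi> (word w J \<omega>)}"
  shows "\<bar>prob (A \<inter> E) - freq c * prob E\<bar> \<le> 8 * e * (freq c * prob E)"
proof -
  let ?I = "{t \<in> J. t < s}" and ?K = "{t \<in> J. s \<le> t}"
  let ?\<Phi> = "\<lambda>u v. \<Phi> (\<lambda>t. if t < s then u t else v t)"
  let ?P = "\<lambda>u. {\<omega> \<in> space M. word w ?I \<omega> = u}" and ?F = "\<lambda>v. {\<omega> \<in> space M. word w ?K \<omega> = v}"
  let ?R = "{(u, v) \<in> range (word w ?I) \<times> range (word w ?K). ?\<Phi> u v}"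
  have fin: "finite ?I" "finite ?K" using J by auto
  have "word w J \<omega> = (\<lambda>t. if t < s then word w ?I \<omega> t else word w ?K \<omega> t)" for \<omega>
    by (auto simp: word_def fun_eq_iff)
  then have E: "E = {\<omega> \<in> space M. ?\<Phi> (word w ?I \<omega>) (word w ?K \<omega>)}"
    by (simp add: E_def)
  have A: "A \<in> process_sigma M \<xi> {s}" unfolding A_def by (rule symbol_event) simp
  then have A_sets: "A \<in> events" using process_sigma_subset_sets[of \<xi> M, OF measurable_process] by blast
  have E_sets: "E \<in> events" unfolding E_def by (rule word_event_sets[OF J(1)])
  have cell: "\<bar>prob (A \<inter> ?P u \<inter> ?F v) - freq c * prob (space M \<inter> ?P u \<inter> ?F v)\<bar>
      \<le> 8 * e * (freq c * prob (space M \<inter> ?P u \<inter> ?F v))" for u v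
  proof -
    have P: "?P u \<in> process_sigma M \<xi> {t. t + L \<le> s}"
      by (rule word_event) (use J L in \<open>force+\<close>)
    have F: "?F v \<in> process_sigma M \<xi> {s + L..}"
      by (rule word_event) (use J L in \<open>force+\<close>)
    interpret S: sigma_algebra "space M" "process_sigma M \<xi> {s..}"
      by (rule sigma_algebra_process_sigma)
    have F': "?F v \<in> process_sigma M \<xi> {s..}"
      using F process_sigma_mono[of "{s + L..}" "{s..}"] by auto
    have AF: "A \<inter> ?F v \<in> process_sigma M \<xi> {s..}"
      using F' A process_sigma_mono[of "{s}" "{s..}"] by (intro S.Int) auto
    have AF1: "\<bar>prob (A \<inter> ?F v) - prob A * prob (?F v)\<bar> \<le> e * (prob A * prob (?F v))"
      by (rule past_future_bound[OF psi e(1), where s = "s + L"])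
         (use F A process_sigma_mono[of "{s}" "{t. t + L \<le> s + L}"] in auto)
    have PF: "\<bar>prob (?P u \<inter> ?F v) - prob (?P u) * prob (?F v)\<bar> \<le> e * (prob (?P u) * prob (?F v))"
      by (rule past_future_bound[OF psi e(1) P F'])
    have PAF: "\<bar>prob (?P u \<inter> (A \<inter> ?F v)) - prob (?P u) * prob (A \<inter> ?F v)\<bar>
        \<le> e * (prob (?P u) * prob (A \<inter> ?F v))"
      by (rule past_future_bound[OF psi e(1) P AF])
    have prA: "prob A = freq c" unfolding A_def by (rule prob_symbol)
    define z where "z = prob (?P u) * (freq c * prob (?F v))"
    define x where "x = prob (?P u \<inter> (A \<inter> ?F v))"
    define y where "y = freq c * prob (?P u \<inter> ?F v)"
    define b where "b = prob (?P u) * prob (A \<inter> ?F v)"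
    have z: "0 \<le> z" by (simp add: z_def freq_nonneg)
    have b: "\<bar>b - z\<bar> \<le> e * z"
      using abs_diff_scaled[OF _ AF1, of "prob (?P u)"] by (simp add: b_def z_def prA mult.left_commute)
    have y: "\<bar>y - z\<bar> \<le> e * z"
      using abs_diff_scaled[OF freq_nonneg PF, of c] by (simp add: y_def z_def mult.left_commute)
    have x: "\<bar>x - b\<bar> \<le> e * b" using PAF by (simp add: x_def b_def)
    have ez: "0 \<le> e * z" "e * z \<le> z / 2" using e z mult_right_mono[of e "1/2" z] by auto
    have eb: "e * b \<le> e * (2 * z)" using b ez e by (intro mult_left_mono) auto
    have ey: "e * z \<le> e * (2 * y)" using y ez e by (intro mult_left_mono) auto
    have "\<bar>x - y\<bar> \<le> 4 * (e * z)" using x b y eb by linarith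
    also have "\<dots> \<le> 8 * e * y" using ey by linarith
    finally have main: "\<bar>x - y\<bar> \<le> 8 * e * y" .
    have "A \<inter> ?P u \<inter> ?F v = ?P u \<inter> (A \<inter> ?F v)" "space M \<inter> ?P u \<inter> ?F v = ?P u \<inter> ?F v" by auto
    with main show ?thesis by (simp add: x_def y_def)
  qed
  have sum1: "prob (A \<inter> E) = (\<Sum>(u, v)\<in>?R. prob (A \<inter> ?P u \<inter> ?F v))"
    unfolding E by (rule prob_split_words[OF fin A_sets])
  have "prob E = prob (space M \<inter> E)" using E_sets by simp
  also have "\<dots> = (\<Sum>(u, v)\<in>?R. prob (space M \<inter> ?P u \<inter> ?F v))"
    unfolding E by (rule prob_split_words[OF fin]) auto
  finally have sum2: "prob E = (\<Sum>(u, v)\<in>?R. prob (space M \<inter> ?P u \<inter> ?F v))" .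
  have "\<bar>prob (A \<inter> E) - freq c * prob E\<bar>
     \<le> (\<Sum>(u, v)\<in>?R. \<bar>prob (A \<inter> ?P u \<inter> ?F v) - freq c * prob (space M \<inter> ?P u \<inter> ?F v)\<bar>)"
    unfolding sum1 sum2 sum_distrib_left case_prod_unfold sum_subtractf[symmetric] by (rule sum_abs)
  also have "\<dots> \<le> (\<Sum>(u, v)\<in>?R. 8 * e * (freq c * prob (space M \<inter> ?P u \<inter> ?F v)))"
    using cell by (intro sum_mono) auto
  also have "\<dots> = 8 * e * (freq c * prob E)"
    unfolding sum2 by (simp add: sum_distrib_left case_prod_unfold)
  finally show ?thesis .
qed

text \<open>
  The sites are split off one at a time: those not yet split off are far from the current one as
  well, hence they can be treated as part of the word over \<open>F \<union> J\<close>.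
\<close>

lemma sites_decoupling:
  assumes psi: "psi_coeff M \<xi> L \<le> ennreal e" and e: "0 \<le> e" "e \<le> 1/2" and L: "L \<ge> 1"
    and J: "finite J" and F: "finite F"
    and sep: "\<And>s t. s \<in> F \<Longrightarrow> t \<in> F \<Longrightarrow> s < t \<Longrightarrow> s + L \<le> t"
    and far: "\<And>s t. s \<in> F \<Longrightarrow> t \<in> J \<Longrightarrow> t + L \<le> s \<or> s + L \<le> t"
  shows "\<bar>prob ({\<omega> \<in> space M. \<forall>s\<in>F. w s \<omega> = c} \<inter> {\<omega> \<in> space M. \<Phi> (word w J \<omega>)})
      - freq c ^ card F * prob {\<omega> \<in> space M. \<Phi> (word w J \<omega>)}\<bar>
    \<le> ((1 + 8 * e) ^ card F - 1) * (freq c ^ card F * prob {\<omega> \<in> space M. \<Phi> (word w J \<omega>)})"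
  using F sep far
proof (induction F rule: finite_induct)
  case empty
  have "{\<omega> \<in> space M. \<Phi> (word w J \<omega>)} \<inter> space M = {\<omega> \<in> space M. \<Phi> (word w J \<omega>)}" by auto
  then show ?case by (simp add: Int_commute)
next
  case (insert s F)
  let ?E = "{\<omega> \<in> space M. \<Phi> (word w J \<omega>)}"
  let ?A = "\<lambda>F. {\<omega> \<in> space M. \<forall>s\<in>F. w s \<omega> = c}"
  let ?\<Psi> = "\<lambda>v. (\<forall>s\<in>F. v s = c) \<and> \<Phi> (\<lambda>t. if t \<in> J then v t else Blank)"
  define x where "x = prob (?A F \<inter> ?E)"
  define y where "y = freq c ^ card F * prob ?E"
  define d where "d = (1 + 8 * e) ^ card F - 1"
  have "word w J \<omega> = (\<lambda>t. if t \<in> J then word w (F \<union> J) \<omega> t else Blank)" for \<omega>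
    by (auto simp: word_def fun_eq_iff)
  then have E: "?A F \<inter> ?E = {\<omega> \<in> space M. ?\<Psi> (word w (F \<union> J) \<omega>)}"
    by (auto simp: word_def)
  have far': "t + L \<le> s \<or> s + L \<le> t" if "t \<in> F \<union> J" for t
    using that insert.hyps insert.prems(1)[of s t] insert.prems(1)[of t s] insert.prems(2)[of s t]
    by (metis UnE insertCI linorder_neqE_nat)
  have IH: "\<bar>x - y\<bar> \<le> d * y"
    unfolding x_def y_def d_def by (rule insert.IH) (use insert.prems in auto)
  have "\<bar>prob ({\<omega> \<in> space M. w s \<omega> = c} \<inter> (?A F \<inter> ?E)) - freq c * x\<bar> \<le> 8 * e * (freq c * x)"
    unfolding x_def E
    by (rule site_decoupling[OF psi e _ far' L]) (use J insert.hyps in auto)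
  moreover have "{\<omega> \<in> space M. w s \<omega> = c} \<inter> (?A F \<inter> ?E) = ?A (insert s F) \<inter> ?E" by auto
  ultimately have step: "\<bar>prob (?A (insert s F) \<inter> ?E) - freq c * x\<bar> \<le> 8 * e * (freq c * x)" by simp
  have "x \<le> (1 + d) * y" using IH by (simp add: algebra_simps)
  then have xy: "8 * e * (freq c * x) \<le> 8 * e * (freq c * ((1 + d) * y))"
    using e freq_nonneg by (intro mult_left_mono) auto
  have "\<bar>freq c * x - freq c * y\<bar> \<le> freq c * (d * y)"
    by (rule abs_diff_scaled[OF freq_nonneg IH])
  with step xy have "\<bar>prob (?A (insert s F) \<inter> ?E) - freq c * y\<bar>
      \<le> 8 * e * (freq c * ((1 + d) * y)) + freq c * (d * y)" by linarith
  also have "\<dots> = ((1 + 8 * e) * (1 + d) - 1) * (freq c * y)" by (simp add: algebra_simps)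
  finally show ?case using insert.hyps by (simp add: y_def d_def mult.assoc)
qed

text \<open>
  Distinct sites are at distance at least 1, so finiteness of the first mixing coefficient suffices
  for a product bound up to a constant, however close the sites are.
\<close>

lemma sites_upper_bound:
  assumes psi: "psi_coeff M \<xi> 1 \<le> ennreal e" and e: "0 \<le> e" and F: "finite F"
  shows "prob {\<omega> \<in> space M. \<forall>s\<in>F. w s \<omega> = c s} \<le> (1 + e) ^ card F * (\<Prod>s\<in>F. freq (c s))"
  using F
proof (induction F rule: finite_linorder_max_induct)
  case empty
  then show ?case by (simp add: prob_space)
next
  case (insert s F)
  let ?A = "\<lambda>F. {\<omega> \<in> space M. \<forall>s\<in>F. w s \<omega> = c s}"
  let ?B = "{\<omega> \<in> space M. w s \<omega> = c s}"
  have "?A F = {\<omega> \<in> space M. (\<lambda>v. \<forall>s\<in>F. v s = c s) (word w F \<omega>)}"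
    by (auto simp: word_def)
  also have "\<dots> \<in> process_sigma M \<xi> {t. t + 1 \<le> s}"
    by (rule word_event) (use insert in auto)
  finally have A: "?A F \<in> process_sigma M \<xi> {t. t + 1 \<le> s}" .
  have B: "?B \<in> process_sigma M \<xi> {s..}" by (rule symbol_event) auto
  have "?A (insert s F) = ?A F \<inter> ?B" by auto
  then have "prob (?A (insert s F)) \<le> (1 + e) * (prob (?A F) * freq (c s))"
    using past_future_bound[OF psi e A B] by (simp add: prob_symbol algebra_simps)
  also have "\<dots> \<le> (1 + e) * (((1 + e) ^ card F * (\<Prod>s\<in>F. freq (c s))) * freq (c s))"
    using insert e freq_nonneg by (intro mult_left_mono mult_right_mono) auto
  also have "\<dots> = (1 + e) ^ card (insert s F) * (\<Prod>s\<in>insert s F. freq (c s))"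
    using insert by (subst prod.insert, simp, blast) (simp add: card_insert_if, metis less_irrefl)
  finally show ?case .
qed

end

section \<open>Hits before the first hazard in a sequence of marks\<close>

definition history :: "(nat \<Rightarrow> 'a \<Rightarrow> symbol) \<Rightarrow> nat \<Rightarrow> 'a \<Rightarrow> symbol list" where
  "history Y n \<omega> = map (\<lambda>m. Y m \<omega>) [0..<n]"

lemma history_0: "history Y 0 \<omega> = []"
  and history_Suc: "history Y (Suc n) \<omega> = history Y n \<omega> @ [Y n \<omega>]"
  by (simp_all add: history_def)

lemma mem_history: "m < n \<Longrightarrow> Y m \<omega> \<in> set (history Y n \<omega>)"
  by (simp add: history_def)

locale marked_sequence = prob_space M for M :: "'a measure" +
  fixes Y :: "nat \<Rightarrow> 'a \<Rightarrow> symbol"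
  assumes mark_event: "\<And>n c. {\<omega> \<in> space M. Y n \<omega> = c} \<in> events"
begin

lemma history_event: "{\<omega> \<in> space M. \<Psi> (history Y n \<omega>)} \<in> events"
proof (induction n arbitrary: \<Psi>)
  case 0
  then show ?case by (cases "\<Psi> []") (simp_all add: history_0)
next
  case (Suc n)
  have "{\<omega> \<in> space M. \<Psi> (history Y (Suc n) \<omega>)} =
    (\<Union>c\<in>UNIV. {\<omega> \<in> space M. \<Psi> (history Y n \<omega> @ [c])} \<inter> {\<omega> \<in> space M. Y n \<omega> = c})"
    by (auto simp: history_Suc)
  then show ?case using Suc[of "\<lambda>xs. \<Psi> (xs @ [c])" for c] mark_event by auto
qed

abbreviation marked :: "nat \<Rightarrow> symbol \<Rightarrow> 'a set" where
  "marked n c \<equiv> {\<omega> \<in> space M. Y n \<omega> = c}"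

text \<open>
  The three events say that no hazard occurs before time \<open>n\<close>, that in addition exactly \<open>k\<close> hits occur
  before time \<open>n\<close>, and that the first hazard occurs before time \<open>T\<close> and is preceded by exactly \<open>k\<close> hits.
\<close>

definition survival :: "nat \<Rightarrow> 'a set" where
  "survival n = {\<omega> \<in> space M. Hazard \<notin> set (history Y n \<omega>)}"

definition survival_with :: "nat \<Rightarrow> nat \<Rightarrow> 'a set" where
  "survival_with k n =
     {\<omega> \<in> space M. Hazard \<notin> set (history Y n \<omega>) \<and> count_list (history Y n \<omega>) Hit = k}"

definition hazard_with :: "nat \<Rightarrow> nat \<Rightarrow> 'a set" where
  "hazard_with k T = (\<Union>n<T. survival_with k n \<inter> marked n Hazard)"

lemma survival_events [measurable]:
  "survival n \<in> events" "survival_with k n \<in> events" "hazard_with k n \<in> events"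
  unfolding survival_def survival_with_def hazard_with_def
  by (intro history_event sets.finite_UN sets.Int mark_event; simp)+

lemma prob_split_mark:
  assumes "A \<in> events"
  shows "prob A = prob (A \<inter> marked n Hazard) + prob (A \<inter> marked n Hit) + prob (A \<inter> marked n Blank)"
proof -
  have "A = (A \<inter> marked n Hazard \<union> A \<inter> marked n Hit) \<union> A \<inter> marked n Blank"
    using sets.sets_into_space[OF assms] symbol.exhaust by auto
  also have "prob \<dots> = prob (A \<inter> marked n Hazard \<union> A \<inter> marked n Hit) + prob (A \<inter> marked n Blank)"
    using assms mark_event by (intro finite_measure_Union) auto
  also have "prob (A \<inter> marked n Hazard \<union> A \<inter> marked n Hit)
      = prob (A \<inter> marked n Hazard) + prob (A \<inter> marked n Hit)"
    using assms mark_event by (intro finite_measure_Union) auto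
  finally show ?thesis .
qed

lemma survival_balance:
  "prob (survival n) = prob (survival n \<inter> marked n Hazard) + prob (survival (Suc n))"
proof -
  have "survival n = survival n \<inter> marked n Hazard \<union> survival (Suc n)"
    by (auto simp: survival_def history_Suc)
  also have "prob \<dots> = prob (survival n \<inter> marked n Hazard) + prob (survival (Suc n))"
    by (intro finite_measure_Union sets.Int mark_event survival_events)
       (auto simp: survival_def history_Suc)
  finally show ?thesis .
qed

text \<open>
  This is the discrete Kolmogorov equation for the number of hits among the paths that have not
  yet met a hazard.
\<close>

lemma survival_with_balance:
  "prob (survival_with k (Suc n)) + prob (survival_with k n \<inter> marked n Hazard)
      + prob (survival_with k n \<inter> marked n Hit)
    = prob (survival_with k n)
      + (if k = 0 then 0 else prob (survival_with (k - 1) n \<inter> marked n Hit))"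
proof -
  let ?B = "if k = 0 then {} else survival_with (k - 1) n \<inter> marked n Hit"
  have "survival_with k (Suc n) = survival_with k n \<inter> marked n Blank \<union> ?B"
  proof (rule set_eqI)
    fix \<omega>
    show "\<omega> \<in> survival_with k (Suc n) \<longleftrightarrow> \<omega> \<in> survival_with k n \<inter> marked n Blank \<union> ?B"
      by (cases "Y n \<omega>"; cases k) (auto simp: survival_with_def history_Suc)
  qed
  also have "prob \<dots> = prob (survival_with k n \<inter> marked n Blank) + prob ?B"
    using mark_event survival_events by (intro finite_measure_Union) auto
  finally have "prob (survival_with k (Suc n))
      = prob (survival_with k n \<inter> marked n Blank) + prob ?B" .
  with prob_split_mark[OF survival_events(2)[of k n], of n] show ?thesis by auto
qed

lemma prob_hazard_with:
  "prob (hazard_with k T) = (\<Sum>n<T. prob (survival_with k n \<inter> marked n Hazard))"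
proof -
  have later: "survival_with k n \<inter> marked m Hazard = {}" if "m < n" for m n
  proof -
    have "Y m \<omega> \<in> set (history Y n \<omega>)" for \<omega> by (rule mem_history[OF that])
    then show ?thesis by (auto simp: survival_with_def) (metis (full_types))
  qed
  have "disjoint_family_on (\<lambda>n. survival_with k n \<inter> marked n Hazard) {..<T}"
    unfolding disjoint_family_on_def
  proof (intro ballI impI)
    fix m n :: nat assume "m \<noteq> n"
    then consider "m < n" | "n < m" by linarith
    then show "(survival_with k m \<inter> marked m Hazard) \<inter> (survival_with k n \<inter> marked n Hazard) = {}"
      by cases (use later in blast)+
  qed
  then show ?thesis unfolding hazard_with_def
    using mark_event survival_events by (intro finite_measure_finite_Union) auto
qed

lemma survival_with_subset: "survival_with k n \<subseteq> survival n"
  by (auto simp: survival_def survival_with_def)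

text \<open>
  At each time before \<open>T\<close>, a share of about \<open>p\<close> of the surviving mass, which is at least the mass that
  survives until \<open>T\<close>, is lost to a hazard; the total loss is at most 1.
\<close>

lemma prob_survival_bound:
  assumes "0 < p"
    and hazard: "\<And>n \<Psi>. n < T \<Longrightarrow>
      \<bar>prob ({\<omega> \<in> space M. \<Psi> (history Y n \<omega>)} \<inter> marked n Hazard)
        - p * prob {\<omega> \<in> space M. \<Psi> (history Y n \<omega>)}\<bar> \<le> e n"
  shows "p * real T * prob (survival T) \<le> 1 + (\<Sum>n<T. e n)"
proof -
  have anti: "prob (survival T) \<le> prob (survival n)" if "n < T" for n
    using that by (intro finite_measure_mono survival_events) (auto simp: survival_def history_def)
  have "(\<Sum>n<T. prob (survival n \<inter> marked n Hazard)) = prob (survival 0) - prob (survival T)"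
  proof -
    have "prob (survival n \<inter> marked n Hazard) = prob (survival n) - prob (survival (Suc n))" for n
      using survival_balance[of n] by linarith
    then show ?thesis by (simp only:) (rule sum_lessThan_telescope')
  qed
  then have total: "(\<Sum>n<T. prob (survival n \<inter> marked n Hazard)) \<le> 1"
    using measure_nonneg[of M "survival T"] prob_le_1[of "survival 0"] by linarith
  have "p * real T * prob (survival T) = (\<Sum>n<T. p * prob (survival T))" by simp
  also have "\<dots> \<le> (\<Sum>n<T. prob (survival n \<inter> marked n Hazard) + e n)"
  proof (rule sum_mono)
    fix n assume "n \<in> {..<T}"
    then have n: "n < T" by simp
    have "p * prob (survival T) \<le> p * prob (survival n)" using anti[OF n] assms(1) by simp
    moreover have "\<bar>prob (survival n \<inter> marked n Hazard) - p * prob (survival n)\<bar> \<le> e n"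
      unfolding survival_def by (rule hazard[OF n])
    ultimately show "p * prob (survival T) \<le> prob (survival n \<inter> marked n Hazard) + e n" by linarith
  qed
  also have "\<dots> = (\<Sum>n<T. prob (survival n \<inter> marked n Hazard)) + (\<Sum>n<T. e n)"
    by (rule sum.distrib)
  also have "\<dots> \<le> 1 + (\<Sum>n<T. e n)" using total by simp
  finally show ?thesis .
qed

text \<open>
  Let \<open>U k\<close> be the sum over \<open>n < T\<close> of the probabilities of \<^term>\<open>survival_with k n\<close>.  Summing the
  balance equation over \<open>n\<close> telescopes, and up to errors \<open>(p + r) * U 0 = 1\<close> and
  \<open>(p + r) * U (k + 1) = r * U k\<close>.  Hence \<open>p * U k\<close>, which is about the probability of
  \<^term>\<open>hazard_with k T\<close>, is geometric in \<open>k\<close>.  The errors of the single times only add up, because the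
  equations are never iterated in \<open>n\<close>, and each increment of \<open>k\<close> contributes once more.
\<close>

lemma geometric_count_bound:
  assumes pr: "0 < p" "0 < r"
    and hazard: "\<And>n \<Psi>. n < T \<Longrightarrow>
      \<bar>prob ({\<omega> \<in> space M. \<Psi> (history Y n \<omega>)} \<inter> marked n Hazard)
        - p * prob {\<omega> \<in> space M. \<Psi> (history Y n \<omega>)}\<bar> \<le> e n"
    and hit: "\<And>n \<Psi>. n < T \<Longrightarrow>
      \<bar>prob ({\<omega> \<in> space M. \<Psi> (history Y n \<omega>)} \<inter> marked n Hit)
        - r * prob {\<omega> \<in> space M. \<Psi> (history Y n \<omega>)}\<bar> \<le> e n"
    and X: "X \<in> events" "hazard_with k T \<subseteq> X" "X \<subseteq> hazard_with k T \<union> survival T"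
  shows "\<bar>prob X - p / (p + r) * (1 - p / (p + r)) ^ k\<bar>
    \<le> (real k + 2) * (3 * (\<Sum>n<T. e n) + prob (survival T))"
proof -
  define U where "U k = (\<Sum>n<T. prob (survival_with k n))" for k
  define \<delta> where "\<delta> = prob (survival T)"
  define \<epsilon> where "\<epsilon> = (\<Sum>n<T. e n)"
  define \<theta> where "\<theta> = r / (p + r)"
  have \<theta>: "0 \<le> \<theta>" "\<theta> \<le> 1" "1 - p / (p + r) = \<theta>" using pr by (auto simp: \<theta>_def field_simps)
  have sum_haz: "\<bar>(\<Sum>n<T. prob (survival_with k n \<inter> marked n Hazard)) - p * U k\<bar> \<le> \<epsilon>" for k
  proof -
    have "\<bar>prob (survival_with k n \<inter> marked n Hazard) - p * prob (survival_with k n)\<bar> \<le> e n" if "n < T" for n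
      unfolding survival_with_def
      by (rule hazard[OF that, of "\<lambda>xs. Hazard \<notin> set xs \<and> count_list xs Hit = k"])
    then show ?thesis unfolding U_def \<epsilon>_def sum_distrib_left sum_subtractf[symmetric]
      by (intro order_trans[OF sum_abs] sum_mono) auto
  qed
  have sum_hit: "\<bar>(\<Sum>n<T. prob (survival_with k n \<inter> marked n Hit)) - r * U k\<bar> \<le> \<epsilon>" for k
  proof -
    have "\<bar>prob (survival_with k n \<inter> marked n Hit) - r * prob (survival_with k n)\<bar> \<le> e n" if "n < T" for n
      unfolding survival_with_def
      by (rule hit[OF that, of "\<lambda>xs. Hazard \<notin> set xs \<and> count_list xs Hit = k"])
    then show ?thesis unfolding U_def \<epsilon>_def sum_distrib_left sum_subtractf[symmetric]
      by (intro order_trans[OF sum_abs] sum_mono) auto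
  qed
  have \<epsilon>: "0 \<le> \<epsilon>" using sum_haz[of 0] by linarith
  have end_le: "0 \<le> prob (survival_with k T)" "prob (survival_with k T) \<le> \<delta>" for k
    unfolding \<delta>_def
    by (auto intro!: finite_measure_mono survival_with_subset survival_events)
  have start: "prob (survival_with k 0) = (if k = 0 then 1 else 0)" for k
    by (simp add: survival_with_def history_0 prob_space)
  have tele: "prob (survival_with k T) - prob (survival_with k 0)
     = - (\<Sum>n<T. prob (survival_with k n \<inter> marked n Hazard))
       - (\<Sum>n<T. prob (survival_with k n \<inter> marked n Hit))
       + (if k = 0 then 0 else \<Sum>n<T. prob (survival_with (k - 1) n \<inter> marked n Hit))" for k
  proof -
    have "prob (survival_with k T) - prob (survival_with k 0)
        = (\<Sum>n<T. prob (survival_with k (Suc n)) - prob (survival_with k n))"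
      by (rule sum_lessThan_telescope[symmetric])
    also have "\<dots> = (\<Sum>n<T. - prob (survival_with k n \<inter> marked n Hazard)
        - prob (survival_with k n \<inter> marked n Hit)
        + (if k = 0 then 0 else prob (survival_with (k - 1) n \<inter> marked n Hit)))"
      by (rule sum.cong[OF refl]) (use survival_with_balance[of k] in \<open>smt (verit)\<close>)
    also have "\<dots> = - (\<Sum>n<T. prob (survival_with k n \<inter> marked n Hazard))
       - (\<Sum>n<T. prob (survival_with k n \<inter> marked n Hit))
       + (if k = 0 then 0 else \<Sum>n<T. prob (survival_with (k - 1) n \<inter> marked n Hit))"
      by (simp add: sum.distrib sum_subtractf sum_negf)
    finally show ?thesis .
  qed
  define x where "x k = (p + r) * U k" for k
  have x0: "\<bar>x 0 - 1\<bar> \<le> 3 * \<epsilon> + \<delta>"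
    using tele[of 0, simplified] start[of 0, simplified] end_le[of 0] sum_haz[of 0] sum_hit[of 0] \<epsilon>
    unfolding x_def distrib_right by linarith
  have xSuc: "\<bar>x (Suc k) - \<theta> * x k\<bar> \<le> 3 * \<epsilon> + \<delta>" for k
  proof -
    have "\<theta> * x k = r * U k" using pr by (simp add: \<theta>_def x_def)
    then show ?thesis
      using tele[of "Suc k"] start[of "Suc k"] end_le[of "Suc k"] sum_haz[of "Suc k"]
        sum_hit[of "Suc k"] sum_hit[of k]
      by (simp add: x_def distrib_right)
  qed
  have xk: "\<bar>x k - \<theta> ^ k\<bar> \<le> (real k + 1) * (3 * \<epsilon> + \<delta>)"
  proof (induction k)
    case 0
    then show ?case using x0 by simp
  next
    case (Suc k)
    have "\<bar>\<theta> * x k - \<theta> * \<theta> ^ k\<bar> \<le> \<theta> * ((real k + 1) * (3 * \<epsilon> + \<delta>))"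
      by (rule abs_diff_scaled[OF \<theta>(1) Suc])
    also have "\<dots> \<le> 1 * ((real k + 1) * (3 * \<epsilon> + \<delta>))"
      using \<theta> \<epsilon> by (intro mult_right_mono) (auto simp: \<delta>_def)
    finally show ?case using xSuc[of k] by (simp add: algebra_simps)
  qed
  have \<rho>: "0 \<le> p / (p + r)" "p / (p + r) \<le> 1" using pr by auto
  have "\<bar>p / (p + r) * x k - p / (p + r) * \<theta> ^ k\<bar> \<le> p / (p + r) * ((real k + 1) * (3 * \<epsilon> + \<delta>))"
    by (rule abs_diff_scaled[OF \<rho>(1) xk])
  also have "\<dots> \<le> 1 * ((real k + 1) * (3 * \<epsilon> + \<delta>))"
    using \<rho> \<epsilon> by (intro mult_right_mono) (auto simp: \<delta>_def)
  also have "p / (p + r) * x k = p * U k" using pr by (simp add: x_def)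
  finally have "\<bar>p * U k - p / (p + r) * \<theta> ^ k\<bar> \<le> (real k + 1) * (3 * \<epsilon> + \<delta>)" by simp
  moreover have "\<bar>prob (hazard_with k T) - p * U k\<bar> \<le> \<epsilon>"
    unfolding prob_hazard_with by (rule sum_haz)
  moreover have "prob (hazard_with k T) \<le> prob X"
    using X by (intro finite_measure_mono) auto
  moreover have "prob X \<le> prob (hazard_with k T) + \<delta>"
    unfolding \<delta>_def using X survival_events
    by (intro order_trans[OF finite_measure_mono[OF X(3)]] measure_Un_le) auto
  moreover have "(real k + 2) * (3 * \<epsilon> + \<delta>) = (real k + 1) * (3 * \<epsilon> + \<delta>) + (3 * \<epsilon> + \<delta>)"
    by (simp add: algebra_simps)
  ultimately show ?thesis unfolding \<theta>(3) \<epsilon>_def[symmetric] \<delta>_def[symmetric] using \<epsilon> by linarith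
qed

definition stopped_count :: "'a \<Rightarrow> ereal" where
  "stopped_count \<omega> = partial_sum (\<lambda>n \<omega>. of_bool (Y n \<omega> = Hit))
     (hazard_time (\<lambda>n \<omega>. of_bool (Y n \<omega> = Hazard)) \<omega>) \<omega>"

lemma count_history: "real (count_list (history Y n \<omega>) Hit) = (\<Sum>m<n. of_bool (Y m \<omega> = Hit))"
  by (induction n) (auto simp: history_0 history_Suc)

lemma set_history: "set (history Y n \<omega>) = (\<lambda>m. Y m \<omega>) ` {..<n}"
  by (auto simp: history_def)

lemma stopped_count_hazard:
  assumes "Y n \<omega> = Hazard" "Hazard \<notin> set (history Y n \<omega>)"
  shows "stopped_count \<omega> = ereal (real (count_list (history Y n \<omega>) Hit))"
proof -
  have "hazard_time (\<lambda>n \<omega>. of_bool (Y n \<omega> = Hazard) :: real) \<omega> = enat n"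
    unfolding hazard_time_def
  proof (rule antisym)
    show "(INF n\<in>{n. of_bool (Y n \<omega> = Hazard) = (1::real)}. enat n) \<le> enat n"
      using assms by (intro INF_lower) simp
    show "enat n \<le> (INF n\<in>{n. of_bool (Y n \<omega> = Hazard) = (1::real)}. enat n)"
    proof (rule INF_greatest)
      fix m assume "m \<in> {n. of_bool (Y n \<omega> = Hazard) = (1::real)}"
      then have "Y m \<omega> = Hazard" by (simp split: if_splits)
      with assms(2) show "enat n \<le> enat m" by (metis enat_ord_simps(1) imageI lessThan_iff not_less set_history)
    qed
  qed
  then show ?thesis by (simp add: stopped_count_def partial_sum_def count_history)
qed

lemma stopped_count_no_hazard:
  assumes "\<And>n. Y n \<omega> \<noteq> Hazard"
  shows "stopped_count \<omega> = (\<Sum>n. ereal (of_bool (Y n \<omega> = Hit)))"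
  using assms by (simp add: stopped_count_def partial_sum_def hazard_time_def top_enat_def)

lemma first_hazard:
  assumes "Hazard \<in> set (history Y T \<omega>)"
  obtains n where "n < T" "Y n \<omega> = Hazard" "Hazard \<notin> set (history Y n \<omega>)"
proof -
  obtain m where m: "m < T" "Y m \<omega> = Hazard" using assms by (auto simp: set_history)
  define n where "n = (LEAST n. Y n \<omega> = Hazard)"
  have "Y n \<omega> = Hazard" unfolding n_def by (rule LeastI[of _ m]) (rule m(2))
  moreover have "n \<le> m" unfolding n_def by (rule Least_le) (rule m(2))
  moreover have "Y i \<omega> \<noteq> Hazard" if "i < n" for i using that unfolding n_def by (rule not_less_Least)
  then have "Hazard \<notin> set (history Y n \<omega>)" by (auto simp: set_history) (metis (full_types))
  ultimately show ?thesis using that[of n] m(1) by simp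
qed

text \<open>
  Cancelling the hits after the first hazard turns the sum up to a random time into one series of
  measurable functions, valid whether or not a hazard occurs.
\<close>

lemma stopped_count_series:
  "stopped_count \<omega> = (\<Sum>n. ereal (of_bool (Hazard \<notin> set (history Y n \<omega>) \<and> Y n \<omega> = Hit)))"
proof (cases "\<exists>n. Y n \<omega> = Hazard")
  case False
  then have "Hazard \<notin> set (history Y n \<omega>)" for n by (simp add: set_history image_iff) metis
  with False show ?thesis by (subst stopped_count_no_hazard) auto
next
  case True
  then obtain m where "Y m \<omega> = Hazard" ..
  then have "Hazard \<in> set (history Y (Suc m) \<omega>)" using mem_history[of m "Suc m" Y \<omega>] by simp
  then obtain n where n: "Y n \<omega> = Hazard" "Hazard \<notin> set (history Y n \<omega>)" by (rule first_hazard)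
  have "(\<Sum>m. ereal (of_bool (Hazard \<notin> set (history Y m \<omega>) \<and> Y m \<omega> = Hit)))
      = (\<Sum>m<n. ereal (of_bool (Hazard \<notin> set (history Y m \<omega>) \<and> Y m \<omega> = Hit)))"
  proof (rule suminf_finite)
    fix m assume "m \<notin> {..<n}"
    then consider "m = n" | "n < m" by force
    then show "ereal (of_bool (Hazard \<notin> set (history Y m \<omega>) \<and> Y m \<omega> = Hit)) = 0"
      by cases (use n(1) mem_history[of n m Y \<omega>] in auto)
  qed simp
  also have "\<dots> = (\<Sum>m<n. ereal (of_bool (Y m \<omega> = Hit)))"
    using n(2) by (intro sum.cong) (auto simp: set_history)
  finally show ?thesis
    by (simp add: stopped_count_hazard[OF n] count_history)
qed

lemma measurable_stopped_count [measurable]: "stopped_count \<in> borel_measurable M"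
proof -
  have [measurable]: "Measurable.pred M (\<lambda>\<omega>. Hazard \<notin> set (history Y n \<omega>) \<and> Y n \<omega> = Hit)" for n
  proof -
    have "{\<omega> \<in> space M. Hazard \<notin> set (history Y n \<omega>) \<and> Y n \<omega> = Hit} = survival n \<inter> marked n Hit"
      by (auto simp: survival_def)
    then show ?thesis
      using survival_events(1)[of n] mark_event[of n Hit] by (simp add: pred_def sets.Int)
  qed
  have "stopped_count = (\<lambda>\<omega>. SUP N. \<Sum>n<N. ereal (of_bool (Hazard \<notin> set (history Y n \<omega>) \<and> Y n \<omega> = Hit)))"
    unfolding stopped_count_series[abs_def] by (rule ext, rule suminf_ereal_eq_SUP) simp
  then show ?thesis by simp
qed

text \<open>
  The event that the count equals \<open>k\<close> is determined before time \<open>T\<close> except on the paths that survive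
  until \<open>T\<close>.
\<close>

lemma stopped_count_bounds:
  shows "hazard_with k T \<subseteq> {\<omega> \<in> space M. stopped_count \<omega> = ereal (real k)}"
    and "{\<omega> \<in> space M. stopped_count \<omega> = ereal (real k)} \<subseteq> hazard_with k T \<union> survival T"
proof -
  show "hazard_with k T \<subseteq> {\<omega> \<in> space M. stopped_count \<omega> = ereal (real k)}"
    by (auto simp: hazard_with_def survival_with_def stopped_count_hazard)
  show "{\<omega> \<in> space M. stopped_count \<omega> = ereal (real k)} \<subseteq> hazard_with k T \<union> survival T"
  proof
    fix \<omega> assume \<omega>: "\<omega> \<in> {\<omega> \<in> space M. stopped_count \<omega> = ereal (real k)}"
    show "\<omega> \<in> hazard_with k T \<union> survival T"
    proof (cases "Hazard \<in> set (history Y T \<omega>)")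
      case True
      then obtain n where "n < T" "Y n \<omega> = Hazard" "Hazard \<notin> set (history Y n \<omega>)"
        by (rule first_hazard)
      with \<omega> show ?thesis
        by (auto simp: hazard_with_def survival_with_def stopped_count_hazard)
    qed (use \<omega> in \<open>simp add: survival_def\<close>)
  qed
qed

end

section \<open>Marks of a nonconventional array\<close>

definition mark :: "nat \<Rightarrow> (nat \<Rightarrow> nat \<Rightarrow> nat) \<Rightarrow> (nat \<Rightarrow> symbol) \<Rightarrow> nat \<Rightarrow> symbol" where
  "mark l q v n = (if \<forall>i\<in>{1..l}. v (q i n) = Hazard then Hazard
     else if \<forall>i\<in>{1..l}. v (q i n) = Hit then Hit else Blank)"

lemma (in prob_space) prob_diff_le:
  assumes "A \<in> events" "B \<in> events" "D \<in> events" "A \<subseteq> B \<union> D" "B \<subseteq> A \<union> D"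
  shows "\<bar>prob A - prob B\<bar> \<le> prob D"
proof -
  have "prob A \<le> prob B + prob D"
    using assms by (intro order_trans[OF finite_measure_mono[OF assms(4)]] measure_Un_le) auto
  moreover have "prob B \<le> prob A + prob D"
    using assms by (intro order_trans[OF finite_measure_mono[OF assms(5)]] measure_Un_le) auto
  ultimately show ?thesis by linarith
qed

locale symbolic_array = symbolic_process +
  fixes l :: nat and q :: "nat \<Rightarrow> nat \<Rightarrow> nat"
  assumes l_pos: "1 \<le> l"
    and strict_mono_q: "\<And>i. i \<in> {1..l} \<Longrightarrow> strict_mono (q i)"
    and q_increasing: "\<And>i n. i \<in> {1..l - 1} \<Longrightarrow> q i n < q (i + 1) n"
begin

definition sites :: "nat \<Rightarrow> nat set" where "sites n = (\<lambda>i. q i n) ` {1..l}"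

definition Y :: "nat \<Rightarrow> 'a \<Rightarrow> symbol" where "Y n \<omega> = mark l q (\<lambda>s. w s \<omega>) n"

text \<open>
  The earlier times \<open>m\<close> of which some site lies at distance less than \<open>L\<close> from some site of time \<open>n\<close>.  They
  need not be near \<open>n\<close>: different functions \<open>q i\<close> can reach the same region at very different times.
\<close>

definition close :: "nat \<Rightarrow> nat \<Rightarrow> nat set" where
  "close L n = {m. m < n \<and> (\<exists>s\<in>sites n. \<exists>t\<in>sites m. t < s + L \<and> s < t + L)}"

lemma q_gap:
  assumes gap: "\<And>i. i \<in> {1..l - 1} \<Longrightarrow> q i n + L \<le> q (i + 1) n" and i: "1 \<le> i"
  shows "i + d < l \<Longrightarrow> q i n + L \<le> q (i + Suc d) n"
proof (induction d)
  case 0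
  then show ?case using gap[of i] i by auto
next
  case (Suc d)
  have "q (i + Suc d) n + L \<le> q (i + Suc d + 1) n"
    by (rule gap) (use Suc.prems in auto)
  with Suc show ?case by simp
qed

lemma q_less:
  assumes "1 \<le> i" "i < j" "j \<le> l"
  shows "q i n < q j n"
  using q_gap[of n 1 i "j - Suc i"] q_increasing[of _ n] assms by (auto simp: Suc_le_eq)

lemma inj_on_q: "inj_on (\<lambda>i. q i n) {1..l}"
proof (rule linorder_inj_onI)
  fix i j assume "i < j" "i \<in> {1..l}" "j \<in> {1..l}"
  then show "q i n \<noteq> q j n" using q_less[of i j n] by auto
qed auto

lemma finite_sites: "finite (sites n)" and card_sites: "card (sites n) = l"
  by (simp_all add: sites_def card_image[OF inj_on_q] del: One_nat_def)

lemma sites_separated: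
  assumes gap: "\<And>i. i \<in> {1..l - 1} \<Longrightarrow> q i n + L \<le> q (i + 1) n"
    and "s \<in> sites n" "t \<in> sites n" "s < t"
  shows "s + L \<le> t"
proof -
  obtain i j where ij: "i \<in> {1..l}" "j \<in> {1..l}" "s = q i n" "t = q j n"
    using assms by (auto simp: sites_def)
  have "i < j"
  proof (rule ccontr)
    assume "\<not> i < j"
    then consider "i = j" | "j < i" by linarith
    then show False using ij assms(4) q_less[of j i n] by cases auto
  qed
  then show ?thesis using q_gap[OF gap, of i "j - Suc i"] ij by auto
qed

lemma mark_iff:
  assumes "c \<noteq> Blank"
  shows "mark l q v n = c \<longleftrightarrow> (\<forall>s\<in>sites n. v s = c)"
proof -
  have one: "1 \<in> {1..l}" using l_pos by simp
  show ?thesis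
  proof (cases c)
    case Hit
    have "\<not> (\<forall>i\<in>{1..l}. v (q i n) = Hazard)" if "\<forall>i\<in>{1..l}. v (q i n) = Hit"
      using that one by (metis symbol.distinct(1))
    with Hit show ?thesis by (auto simp: mark_def sites_def)
  qed (use assms in \<open>auto simp: mark_def sites_def\<close>)
qed

lemma mark_cong: "(\<And>s. s \<in> sites n \<Longrightarrow> u s = v s) \<Longrightarrow> mark l q u n = mark l q v n"
  by (auto simp: mark_def sites_def)

lemma mark_Blank: "s \<in> sites n \<Longrightarrow> v s = Blank \<Longrightarrow> mark l q v n = Blank"
  using mark_iff[of Hazard v n] mark_iff[of Hit v n] by (cases "mark l q v n") auto

lemma Y_event: "{\<omega> \<in> space M. Y n \<omega> = c} \<in> events"
proof -
  have "Y n \<omega> = mark l q (word w (sites n) \<omega>) n" for \<omega>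
    unfolding Y_def by (rule mark_cong) (simp add: word_def)
  then show ?thesis using word_event_sets[OF finite_sites[of n], of "\<lambda>v. mark l q v n = c"] by simp
qed

sublocale marked_sequence M Y
  by standard (rule Y_event)

lemma first_site: "q 1 m \<in> sites m"
  using l_pos by (auto simp: sites_def)

text \<open>
  An earlier time always contributes a site that time \<open>n\<close> does not use, even if all its other sites are
  shared with time \<open>n\<close>.
\<close>

lemma first_site_before:
  assumes "m < n" "s \<in> sites n"
  shows "q 1 m < s"
proof -
  obtain i where i: "i \<in> {1..l}" "s = q i n" using assms by (auto simp: sites_def)
  have "q 1 m < q 1 n" using strict_mono_q[of 1] l_pos assms by (auto simp: strict_mono_def)
  also have "q 1 n \<le> s" using i q_less[of 1 i n] by (cases "i = 1") auto
  finally show ?thesis .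
qed

lemma prob_mark_le: "prob {\<omega> \<in> space M. Y m \<omega> \<noteq> Blank} \<le> freq Hazard + freq Hit"
proof -
  have ev: "{\<omega> \<in> space M. w s \<omega> = c} \<in> events" for s c
    using symbol_event[of s UNIV c] process_sigma_subset_sets[of \<xi> M, OF measurable_process] by blast
  have "{\<omega> \<in> space M. Y m \<omega> \<noteq> Blank} \<subseteq>
    {\<omega> \<in> space M. w (q 1 m) \<omega> = Hazard} \<union> {\<omega> \<in> space M. w (q 1 m) \<omega> = Hit}"
    unfolding Y_def mark_def using l_pos by auto
  then have "prob {\<omega> \<in> space M. Y m \<omega> \<noteq> Blank} \<le>
     prob ({\<omega> \<in> space M. w (q 1 m) \<omega> = Hazard} \<union> {\<omega> \<in> space M. w (q 1 m) \<omega> = Hit})"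
    using ev by (intro finite_measure_mono) auto
  also have "\<dots> \<le> prob {\<omega> \<in> space M. w (q 1 m) \<omega> = Hazard} + prob {\<omega> \<in> space M. w (q 1 m) \<omega> = Hit}"
    using ev by (intro measure_Un_le) auto
  finally show ?thesis by (simp add: prob_symbol)
qed

text \<open>
  Two marks that are not blank involve at least \<open>l + 1\<close> distinct sites.  The additional factor of one
  frequency is what makes clusters of marks negligible, since a single mark has probability of the
  order of an \<open>l\<close>-th power.
\<close>

lemma prob_two_marks_le:
  assumes psi: "psi_coeff M \<xi> 1 \<le> ennreal D" "0 \<le> D" and mn: "m < n" and c: "c \<noteq> Blank"
  shows "prob {\<omega> \<in> space M. Y m \<omega> \<noteq> Blank \<and> Y n \<omega> = c}
    \<le> (1 + D) ^ (l + 1) * (freq Hazard + freq Hit) * freq c ^ l"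
proof -
  let ?s = "q 1 m"
  let ?F = "insert ?s (sites n)"
  have new: "?s \<notin> sites n" using first_site_before[OF mn] by blast
  have one: "prob {\<omega> \<in> space M. Y m \<omega> = c' \<and> Y n \<omega> = c} \<le> (1 + D) ^ (l + 1) * (freq c' * freq c ^ l)"
    if c': "c' \<noteq> Blank" for c'
  proof -
    let ?c = "\<lambda>s. if s = ?s then c' else c"
    have "{\<omega> \<in> space M. Y m \<omega> = c' \<and> Y n \<omega> = c} \<subseteq> {\<omega> \<in> space M. \<forall>s\<in>?F. w s \<omega> = ?c s}"
      using first_site[of m] new by (auto simp: Y_def mark_iff c c')
    moreover have "{\<omega> \<in> space M. \<forall>s\<in>?F. w s \<omega> = ?c s} \<in> events"
      using word_event_sets[of ?F "\<lambda>v. \<forall>s\<in>?F. v s = ?c s"] finite_sites by (simp add: word_def)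
    ultimately have "prob {\<omega> \<in> space M. Y m \<omega> = c' \<and> Y n \<omega> = c}
       \<le> prob {\<omega> \<in> space M. \<forall>s\<in>?F. w s \<omega> = ?c s}" by (rule finite_measure_mono)
    also have "\<dots> \<le> (1 + D) ^ card ?F * (\<Prod>s\<in>?F. freq (?c s))"
      by (rule sites_upper_bound[OF psi]) (simp add: finite_sites)
    also have "card ?F = l + 1" using new by (simp add: finite_sites card_sites)
    also have "(\<Prod>s\<in>?F. freq (?c s)) = freq c' * (\<Prod>s\<in>sites n. freq (?c s))"
      using new by (simp add: finite_sites)
    also have "(\<Prod>s\<in>sites n. freq (?c s)) = (\<Prod>s\<in>sites n. freq c)"
      using new by (intro prod.cong) auto
    finally show ?thesis by (simp add: card_sites)
  qed
  have "{\<omega> \<in> space M. Y m \<omega> \<noteq> Blank \<and> Y n \<omega> = c}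
     = (marked m Hazard \<inter> marked n c) \<union> (marked m Hit \<inter> marked n c)" (is "?A = ?B")
  proof (rule set_eqI)
    show "\<omega> \<in> ?A \<longleftrightarrow> \<omega> \<in> ?B" for \<omega> by (cases "Y m \<omega>") auto
  qed
  then have "prob {\<omega> \<in> space M. Y m \<omega> \<noteq> Blank \<and> Y n \<omega> = c}
     \<le> prob (marked m Hazard \<inter> marked n c) + prob (marked m Hit \<inter> marked n c)"
    using Y_event by (simp add: measure_Un_le sets.Int)
  moreover have "prob (marked m c' \<inter> marked n c) \<le> (1 + D) ^ (l + 1) * (freq c' * freq c ^ l)"
    if "c' \<noteq> Blank" for c'
  proof -
    have "marked m c' \<inter> marked n c = {\<omega> \<in> space M. Y m \<omega> = c' \<and> Y n \<omega> = c}" by auto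
    with one[OF that] show ?thesis by simp
  qed
  from add_mono[OF this[of Hazard] this[of Hit]]
  have "prob (marked m Hazard \<inter> marked n c) + prob (marked m Hit \<inter> marked n c)
      \<le> (1 + D) ^ (l + 1) * (freq Hazard + freq Hit) * freq c ^ l"
    by (simp add: algebra_simps)
  ultimately show ?thesis by (rule order_trans)
qed

lemma finite_close: "finite (close L n)"
  by (simp add: close_def)

text \<open>
  For each pair \<open>(i, j)\<close> the sites \<open>q j m\<close> have to fall into a fixed window of length at most \<open>2 * L\<close>, and
  \<open>q j\<close> is injective.
\<close>

lemma card_close: "card (close L n) \<le> l * l * (2 * L)"
proof -
  let ?C = "\<lambda>(i, j). {m. q j m \<in> {q i n + 1 - L..<q i n + L}}"
  have C: "finite (?C (i, j)) \<and> card (?C (i, j)) \<le> 2 * L" if "j \<in> {1..l}" for i j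
  proof -
    have inj: "inj_on (q j) S" for S
      using strict_mono_imp_inj_on[OF strict_mono_q[OF that]] inj_on_subset by blast
    have sub: "q j ` ?C (i, j) \<subseteq> {q i n + 1 - L..<q i n + L}" by auto
    have "finite (?C (i, j))" using finite_vimageI[of "{q i n + 1 - L..<q i n + L}" "q j"] inj
      by (simp add: vimage_def)
    moreover have "card (?C (i, j)) \<le> card {q i n + 1 - L..<q i n + L}"
      by (rule card_inj_on_le[OF inj sub]) simp
    ultimately show ?thesis by simp
  qed
  have "close L n \<subseteq> (\<Union>x\<in>{1..l} \<times> {1..l}. ?C x)"
  proof
    fix m assume "m \<in> close L n"
    then obtain i j where ij: "i \<in> {1..l}" "j \<in> {1..l}" "q j m < q i n + L" "q i n < q j m + L"
      by (auto simp: close_def sites_def)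
    then have "m \<in> ?C (i, j)" by auto
    with ij show "m \<in> (\<Union>x\<in>{1..l} \<times> {1..l}. ?C x)" by blast
  qed
  then have "card (close L n) \<le> card (\<Union>x\<in>{1..l} \<times> {1..l}. ?C x)"
    using C by (intro card_mono finite_UN_I) auto
  also have "\<dots> \<le> (\<Sum>x\<in>{1..l} \<times> {1..l}. card (?C x))"
    by (rule card_UN_le) auto
  also have "\<dots> \<le> (\<Sum>x\<in>{1..l} \<times> {1..l}. 2 * L)"
    using C by (intro sum_mono) auto
  finally show ?thesis by simp
qed

text \<open>
  Blanking the sites near those of time \<open>n\<close> erases exactly the marks of the close times and leaves all
  other earlier marks intact.
\<close>

lemma masked_history:
  fixes L :: nat
  defines "J \<equiv> \<lambda>n. (\<Union>m<n. sites m) - {t. \<exists>s\<in>sites n. t < s + L \<and> s < t + L}"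
  assumes "m < n"
  shows "mark l q (word w (J n) \<omega>) m = (if m \<in> close L n then Blank else Y m \<omega>)"
proof (cases "m \<in> close L n")
  case True
  then obtain t where "t \<in> sites m" "t \<notin> J n" by (auto simp: close_def J_def)
  then show ?thesis using True by (simp add: mark_Blank[of t] word_def)
next
  case False
  then have "t \<in> J n" if "t \<in> sites m" for t
    using that assms(2) by (auto simp: close_def J_def)
  then show ?thesis using False by (auto simp: Y_def word_def intro: mark_cong)
qed

text \<open>
  Erase the marks of the close times from the history.  The altered history is a function of a word
  over sites far from those of time \<open>n\<close>, to which \<open>sites_decoupling\<close> applies.  The alteration has an
  effect only if some close time carries a mark; there are few close times, and each contributes
  an additional factor of one frequency, also jointly with the mark at time \<open>n\<close>.  So the total error is small
  relative to \<open>freq c ^ l\<close>.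
\<close>

lemma history_decoupling:
  assumes psi: "psi_coeff M \<xi> L \<le> ennreal e" and e: "0 \<le> e" "e \<le> 1/2" and L: "L \<ge> 1"
    and psi1: "psi_coeff M \<xi> 1 \<le> ennreal D" "0 \<le> D"
    and gap: "\<And>i. i \<in> {1..l - 1} \<Longrightarrow> q i n + L \<le> q (i + 1) n" and c: "c \<noteq> Blank"
  shows "\<bar>prob ({\<omega> \<in> space M. \<Psi> (history Y n \<omega>)} \<inter> marked n c)
      - freq c ^ l * prob {\<omega> \<in> space M. \<Psi> (history Y n \<omega>)}\<bar>
    \<le> freq c ^ l * ((1 + 8 * e) ^ l - 1
        + real (l * l * (2 * L)) * (((1 + D) ^ (l + 1) + 1) * (freq Hazard + freq Hit)))"
proof -
  define J where "J = (\<Union>m<n. sites m) - {t. \<exists>s\<in>sites n. t < s + L \<and> s < t + L}"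
  let ?\<Phi> = "\<lambda>v. \<Psi> (map (mark l q v) [0..<n])"
  let ?E = "{\<omega> \<in> space M. \<Psi> (history Y n \<omega>)}"
  let ?E' = "{\<omega> \<in> space M. ?\<Phi> (word w J \<omega>)}"
  let ?bad = "\<Union>m\<in>close L n. {\<omega> \<in> space M. Y m \<omega> \<noteq> Blank}"
  have J: "finite J" by (simp add: J_def finite_sites)
  have E: "?E \<in> events" by (rule history_event)
  have E': "?E' \<in> events" by (rule word_event_sets[OF J])
  have nonblank: "{\<omega> \<in> space M. Y m \<omega> \<noteq> Blank} \<in> events" for m
  proof -
    have "{\<omega> \<in> space M. Y m \<omega> \<noteq> Blank} = space M - marked m Blank" by auto
    then show ?thesis using Y_event by auto
  qed
  then have bad: "?bad \<in> events" using finite_close by auto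
  have same: "\<Psi> (history Y n \<omega>) \<longleftrightarrow> ?\<Phi> (word w J \<omega>)"
    if "\<omega> \<in> space M" "\<omega> \<notin> ?bad" for \<omega>
  proof -
    have "mark l q (word w J \<omega>) m = Y m \<omega>" if "m < n" for m
      using masked_history[OF that, of L \<omega>] \<open>\<omega> \<notin> ?bad\<close> \<open>\<omega> \<in> space M\<close> by (auto simp: J_def)
    then have "map (mark l q (word w J \<omega>)) [0..<n] = history Y n \<omega>" by (simp add: history_def)
    then show ?thesis by simp
  qed
  have EE': "\<bar>prob ?E - prob ?E'\<bar> \<le> prob ?bad"
    by (rule prob_diff_le[OF E E' bad]) (use same in auto)
  have AEE': "\<bar>prob (?E \<inter> marked n c) - prob (?E' \<inter> marked n c)\<bar> \<le> prob (?bad \<inter> marked n c)"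
    by (rule prob_diff_le) (use same E E' bad Y_event in auto)
  have count: "real (card (close L n)) * x \<le> real (l * l * (2 * L)) * x" if "0 \<le> x" for x
    using card_close[of L n] that by (intro mult_right_mono of_nat_mono) auto
  let ?f = "freq Hazard + freq Hit"
  have f: "0 \<le> ?f" "0 \<le> freq c ^ l" using freq_nonneg by auto
  have "prob ?bad \<le> (\<Sum>m\<in>close L n. prob {\<omega> \<in> space M. Y m \<omega> \<noteq> Blank})"
    using nonblank finite_close by (intro measure_UNION_le) auto
  also have "\<dots> \<le> real (card (close L n)) * ?f"
    using prob_mark_le by (intro sum_bounded_above) auto
  finally have pbad: "prob ?bad \<le> real (l * l * (2 * L)) * ?f"
    using count[OF f(1)] by simp
  have "prob (?bad \<inter> marked n c)
      = prob (\<Union>m\<in>close L n. {\<omega> \<in> space M. Y m \<omega> \<noteq> Blank} \<inter> marked n c)"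
    by (rule arg_cong[where f = prob]) auto
  also have "\<dots> \<le> (\<Sum>m\<in>close L n. prob ({\<omega> \<in> space M. Y m \<omega> \<noteq> Blank} \<inter> marked n c))"
    using nonblank finite_close Y_event by (intro measure_UNION_le) auto
  also have "\<dots> \<le> real (card (close L n)) * ((1 + D) ^ (l + 1) * ?f * freq c ^ l)"
  proof (rule sum_bounded_above)
    fix m assume "m \<in> close L n"
    then have "m < n" by (simp add: close_def)
    have "{\<omega> \<in> space M. Y m \<omega> \<noteq> Blank} \<inter> marked n c = {\<omega> \<in> space M. Y m \<omega> \<noteq> Blank \<and> Y n \<omega> = c}"
      by auto
    then show "prob ({\<omega> \<in> space M. Y m \<omega> \<noteq> Blank} \<inter> marked n c) \<le> (1 + D) ^ (l + 1) * ?f * freq c ^ l"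
      using prob_two_marks_le[OF psi1 \<open>m < n\<close> c] by simp
  qed
  also have "\<dots> \<le> real (l * l * (2 * L)) * ((1 + D) ^ (l + 1) * ?f * freq c ^ l)"
    using f psi1 by (intro count mult_nonneg_nonneg) auto
  finally have pAbad: "prob (?bad \<inter> marked n c) \<le> real (l * l * (2 * L)) * ((1 + D) ^ (l + 1) * ?f * freq c ^ l)" .
  have Am: "marked n c = {\<omega> \<in> space M. \<forall>s\<in>sites n. w s \<omega> = c}"
    by (simp add: Y_def mark_iff[OF c])
  have "\<bar>prob (marked n c \<inter> ?E') - freq c ^ l * prob ?E'\<bar>
      \<le> ((1 + 8 * e) ^ l - 1) * (freq c ^ l * prob ?E')"
    using sites_decoupling[OF psi e L J finite_sites, of n c ?\<Phi>] sites_separated[OF gap]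
    unfolding Am card_sites by (auto simp: J_def not_less)
  also have "\<dots> \<le> ((1 + 8 * e) ^ l - 1) * (freq c ^ l * 1)"
    using f e by (intro mult_left_mono) auto
  finally have "\<bar>prob (?E' \<inter> marked n c) - freq c ^ l * prob ?E'\<bar> \<le> ((1 + 8 * e) ^ l - 1) * freq c ^ l"
    by (simp add: Int_commute)
  moreover have "\<bar>freq c ^ l * prob ?E - freq c ^ l * prob ?E'\<bar> \<le> freq c ^ l * (real (l * l * (2 * L)) * ?f)"
    using EE' pbad by (intro abs_diff_scaled f) linarith
  ultimately have "\<bar>prob (?E \<inter> marked n c) - freq c ^ l * prob ?E\<bar>
    \<le> ((1 + 8 * e) ^ l - 1) * freq c ^ l + freq c ^ l * (real (l * l * (2 * L)) * ?f)
      + real (l * l * (2 * L)) * ((1 + D) ^ (l + 1) * ?f * freq c ^ l)"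
    using AEE' pAbad by linarith
  also have "\<dots> = freq c ^ l * ((1 + 8 * e) ^ l - 1
        + real (l * l * (2 * L)) * (((1 + D) ^ (l + 1) + 1) * ?f))"
    by (simp only: algebra_simps)
  finally show ?thesis .
qed

text \<open>
  For the finitely many initial times at which the sites of one time are not yet far apart, this crude
  bound is good enough.
\<close>

lemma history_trivial_bound:
  assumes c: "c \<noteq> Blank"
  shows "\<bar>prob ({\<omega> \<in> space M. \<Psi> (history Y n \<omega>)} \<inter> marked n c)
      - freq c ^ l * prob {\<omega> \<in> space M. \<Psi> (history Y n \<omega>)}\<bar> \<le> freq Hazard + freq Hit"
proof -
  let ?E = "{\<omega> \<in> space M. \<Psi> (history Y n \<omega>)}"
  have "marked n c \<subseteq> {\<omega> \<in> space M. Y n \<omega> \<noteq> Blank}" using c by auto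
  moreover have "{\<omega> \<in> space M. Y n \<omega> \<noteq> Blank} = space M - marked n Blank" by auto
  ultimately have "prob (?E \<inter> marked n c) \<le> prob {\<omega> \<in> space M. Y n \<omega> \<noteq> Blank}"
    using Y_event by (intro finite_measure_mono) auto
  also note prob_mark_le
  finally have 1: "prob (?E \<inter> marked n c) \<le> freq Hazard + freq Hit" .
  have "freq c ^ l \<le> freq c ^ 1"
    using l_pos freq_nonneg freq_le_1 by (intro power_decreasing) auto
  then have "freq c ^ l * prob ?E \<le> freq c * 1"
    using freq_nonneg by (intro mult_mono) auto
  also have "\<dots> \<le> freq Hazard + freq Hit" using c freq_nonneg by (cases c) auto
  finally have 2: "freq c ^ l * prob ?E \<le> freq Hazard + freq Hit" .
  have "0 \<le> prob (?E \<inter> marked n c)" "0 \<le> freq c ^ l * prob ?E" using freq_nonneg by auto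
  with 1 2 show ?thesis by linarith
qed

text \<open>
  The horizon is of the order of \<open>K\<close> over the hazard probability: long enough for survival to have
  probability of order \<open>1 / K\<close>, short enough for the errors of \<open>history_decoupling\<close>, which are \<open>\<kappa>\<close> times the
  probability of a mark, to add up to at most a constant times \<open>\<kappa>\<close>.
\<close>

lemma prob_stopped_count_bound:
  assumes psi: "psi_coeff M \<xi> L \<le> ennreal e" and e: "0 \<le> e" "e \<le> 1/2" and L: "L \<ge> 1"
    and psi1: "psi_coeff M \<xi> 1 \<le> ennreal D" "0 \<le> D"
    and gap: "\<And>i n. n \<ge> n0 \<Longrightarrow> i \<in> {1..l - 1} \<Longrightarrow> q i n + L \<le> q (i + 1) n"
    and pos: "0 < freq Hazard" "0 < freq Hit"
    and B: "freq Hit ^ l \<le> B * freq Hazard ^ l"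
    and K: "0 < K"
  defines "\<kappa> \<equiv> (1 + 8 * e) ^ l - 1
        + real (l * l * (2 * L)) * (((1 + D) ^ (l + 1) + 1) * (freq Hazard + freq Hit))"
  defines "\<eta> \<equiv> real n0 * (freq Hazard + freq Hit) + (K + 1) * (1 + B) * \<kappa>"
  defines "\<rho> \<equiv> freq Hazard ^ l / (freq Hazard ^ l + freq Hit ^ l)"
  shows "\<bar>prob {\<omega> \<in> space M. stopped_count \<omega> = ereal (real k)} - \<rho> * (1 - \<rho>) ^ k\<bar>
    \<le> (real k + 2) * (3 * \<eta> + (1 + \<eta>) / K)"
proof -
  define f where "f = freq Hazard + freq Hit"
  define p where "p = freq Hazard ^ l"
  define r where "r = freq Hit ^ l"
  have pr: "0 < p" "0 < r" "p \<le> 1" and f: "0 \<le> f"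
    using pos freq_le_1[of Hazard] by (auto simp: p_def r_def f_def power_le_one)
  have \<kappa>: "0 \<le> \<kappa>" unfolding \<kappa>_def using e psi1 f by (auto simp: f_def)
  \<comment> \<open>Rounding up costs at most \<open>p \<le> 1\<close> in \<open>p * T\<close>, hence the factor \<open>K + 1\<close> in \<open>\<eta>\<close>.\<close>
  define T where "T = nat \<lceil>K / p\<rceil>"
  have T: "K / p \<le> real T" "real T \<le> K / p + 1" 
  proof -
    have "0 \<le> K / p" using K pr by simp
    then show "K / p \<le> real T" "real T \<le> K / p + 1" unfolding T_def by linarith+
  qed
  have T1: "K \<le> p * real T" using T(1) pr by (simp add: field_simps)
  have "p * real T \<le> p * (K / p + 1)" using T(2) pr by (intro mult_left_mono) auto
  also have "\<dots> = K + p" using pr by (simp add: field_simps)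
  finally have T2: "p * real T \<le> K + 1" using pr by linarith
  have B0: "r \<le> B * p" using B by (simp add: p_def r_def)
  then have B1: "0 \<le> B" using pr by (smt (verit) mult_neg_pos)
  have Tpr: "real T * (p + r) \<le> (K + 1) * (1 + B)"
  proof -
    have "real T * (p + r) \<le> real T * ((1 + B) * p)"
      using B0 by (intro mult_left_mono) (auto simp: algebra_simps)
    also have "\<dots> = (p * real T) * (1 + B)" by simp
    also have "\<dots> \<le> (K + 1) * (1 + B)" using T2 B1 by (intro mult_right_mono) auto
    finally show ?thesis .
  qed
  define \<epsilon> where "\<epsilon> n = (if n < n0 then f else (p + r) * \<kappa>)" for n
  have step: "\<bar>prob ({\<omega> \<in> space M. \<Psi> (history Y n \<omega>)} \<inter> marked n c)
      - freq c ^ l * prob {\<omega> \<in> space M. \<Psi> (history Y n \<omega>)}\<bar> \<le> \<epsilon> n"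
    if c: "c = Hazard \<or> c = Hit" for c n \<Psi>
  proof (cases "n < n0")
    case True
    then show ?thesis using history_trivial_bound[of c \<Psi> n] c by (auto simp: \<epsilon>_def f_def)
  next
    case False
    have "\<bar>prob ({\<omega> \<in> space M. \<Psi> (history Y n \<omega>)} \<inter> marked n c)
      - freq c ^ l * prob {\<omega> \<in> space M. \<Psi> (history Y n \<omega>)}\<bar> \<le> freq c ^ l * \<kappa>"
      unfolding \<kappa>_def
      by (rule history_decoupling[OF psi e L psi1]) (use gap False c in auto)
    also have "\<dots> \<le> (p + r) * \<kappa>"
      using c pr \<kappa> by (intro mult_right_mono) (auto simp: p_def r_def)
    finally show ?thesis using False by (simp add: \<epsilon>_def)
  qed
  have "(\<Sum>n<T. \<epsilon> n) \<le> (\<Sum>n<T. (if n < n0 then f else 0) + (p + r) * \<kappa>)"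
    unfolding \<epsilon>_def using f pr \<kappa> by (intro sum_mono) auto
  also have "\<dots> = (\<Sum>n | n < T \<and> n < n0. f) + real T * (p + r) * \<kappa>"
    by (simp add: sum.distrib sum.If_cases Collect_conj_eq lessThan_def)
  also have "(\<Sum>n | n < T \<and> n < n0. f) \<le> real n0 * f"
  proof -
    have "card {n. n < T \<and> n < n0} \<le> card {..<n0}" by (intro card_mono) auto
    then show ?thesis using f by (simp add: mult_right_mono)
  qed
  also have "real T * (p + r) * \<kappa> \<le> (K + 1) * (1 + B) * \<kappa>"
    using Tpr \<kappa> by (intro mult_right_mono)
  finally have sum: "(\<Sum>n<T. \<epsilon> n) \<le> \<eta>" by (simp add: \<eta>_def f_def)
  have step': "\<bar>prob ({\<omega> \<in> space M. \<Psi> (history Y n \<omega>)} \<inter> marked n Hazard)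
      - p * prob {\<omega> \<in> space M. \<Psi> (history Y n \<omega>)}\<bar> \<le> \<epsilon> n"
    "\<bar>prob ({\<omega> \<in> space M. \<Psi> (history Y n \<omega>)} \<inter> marked n Hit)
      - r * prob {\<omega> \<in> space M. \<Psi> (history Y n \<omega>)}\<bar> \<le> \<epsilon> n" for n \<Psi>
    using step[of Hazard] step[of Hit] by (auto simp: p_def r_def)
  have "K * prob (survival T) \<le> p * real T * prob (survival T)"
    by (intro mult_right_mono T1) auto
  also have "\<dots> \<le> 1 + (\<Sum>n<T. \<epsilon> n)"
    by (rule prob_survival_bound[OF pr(1)]) (rule step')
  finally have surv: "prob (survival T) \<le> (1 + \<eta>) / K"
    using sum K by (simp add: field_simps)
  have "\<bar>prob {\<omega> \<in> space M. stopped_count \<omega> = ereal (real k)} - p / (p + r) * (1 - p / (p + r)) ^ k\<bar>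
      \<le> (real k + 2) * (3 * (\<Sum>n<T. \<epsilon> n) + prob (survival T))"
    by (rule geometric_count_bound[OF pr(1,2) step' _ stopped_count_bounds]) measurable
  also have "\<dots> \<le> (real k + 2) * (3 * \<eta> + (1 + \<eta>) / K)"
    using sum surv by (intro mult_left_mono) auto
  finally show ?thesis by (simp add: \<rho>_def p_def r_def)
qed

end

section \<open>Total variation distance to a geometric distribution\<close>

lemma abs_sum_diff_split:
  fixes a b :: "nat \<Rightarrow> real"
  shows "I \<subseteq> {..<K} \<Longrightarrow> \<bar>(\<Sum>k\<in>I. a k) - (\<Sum>k\<in>I. b k)\<bar> \<le> (\<Sum>k<K. \<bar>a k - b k\<bar>)"
  unfolding sum_subtractf[symmetric]
  by (rule order_trans[OF sum_abs]) (auto intro: sum_mono2)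

lemma geometric_partial_mass:
  fixes \<sigma> :: real
  assumes "0 < \<sigma>" "\<sigma> \<le> 1"
  shows "(\<Sum>k<K. \<sigma> * (1 - \<sigma>) ^ k) = 1 - (1 - \<sigma>) ^ K"
  using assms by (induction K) (auto simp: algebra_simps)

text \<open>
  Below \<open>K\<close> the two distributions are compared atom by atom.  The mass that \<open>f\<close> leaves outside the first
  \<open>K\<close> naturals, possible infinite values included, is controlled by the complement: it differs from the
  geometric tail by no more than the atoms do.
\<close>

lemma (in prob_space) diff_measure_Geo_le:
  fixes f :: "'a \<Rightarrow> ereal"
  assumes f [measurable]: "f \<in> borel_measurable M" and \<sigma>: "0 < \<sigma>" "\<sigma> \<le> 1" and G: "G \<in> sets borel"
  shows "\<bar>measure (distr M borel f) G - measure (Geo \<sigma>) G\<bar>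
    \<le> 2 * (\<Sum>k<K. \<bar>prob {\<omega> \<in> space M. f \<omega> = ereal (real k)} - \<sigma> * (1 - \<sigma>) ^ k\<bar>) + (1 - \<sigma>) ^ K"
proof -
  define a where "a k = prob {\<omega> \<in> space M. f \<omega> = ereal (real k)}" for k
  define b where "b k = \<sigma> * (1 - \<sigma>) ^ k" for k
  define I where "I = {k. k < K \<and> ereal (real k) \<in> G}"
  define d where "d = (\<Sum>k<K. \<bar>a k - b k\<bar>)"
  have I: "finite I" "I \<subseteq> {..<K}" by (auto simp: I_def)
  have mu: "prob {\<omega> \<in> space M. \<exists>k\<in>S. f \<omega> = ereal (real k)} = (\<Sum>k\<in>S. a k)" if "finite S" for S
  proof -
    have "{\<omega> \<in> space M. \<exists>k\<in>S. f \<omega> = ereal (real k)} = (\<Union>k\<in>S. {\<omega> \<in> space M. f \<omega> = ereal (real k)})" by auto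
    then show ?thesis unfolding a_def
      using that by (simp, intro finite_measure_finite_Union) (auto simp: disjoint_family_on_def)
  qed
  have nu: "measure_pmf.prob (geometric_pmf \<sigma>) S = (\<Sum>k\<in>S. b k)" if "finite S" for S
    using that \<sigma> by (simp add: measure_measure_pmf_finite b_def mult.commute)
  have split_mu: "(\<Sum>k\<in>I. a k) \<le> measure (distr M borel f) G"
    "measure (distr M borel f) G \<le> (\<Sum>k\<in>I. a k) + (1 - (\<Sum>k<K. a k))"
  proof -
    let ?F = "{\<omega> \<in> space M. \<exists>k\<in>{..<K}. f \<omega> = ereal (real k)}"
    let ?G = "f -` G \<inter> space M"
    have ev: "?G \<in> events" "?F \<in> events" "{\<omega> \<in> space M. \<exists>k\<in>I. f \<omega> = ereal (real k)} \<in> events"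
      using G by measurable
    have m: "measure (distr M borel f) G = prob ?G" using G by (simp add: measure_distr)
    have "prob {\<omega> \<in> space M. \<exists>k\<in>I. f \<omega> = ereal (real k)} \<le> prob ?G"
      using ev by (intro finite_measure_mono) (auto simp: I_def)
    then show "(\<Sum>k\<in>I. a k) \<le> measure (distr M borel f) G" by (simp add: m mu I)
    have "prob ?G \<le> prob ({\<omega> \<in> space M. \<exists>k\<in>I. f \<omega> = ereal (real k)} \<union> (space M - ?F))"
      using ev by (intro finite_measure_mono) (auto simp: I_def)
    also have "\<dots> \<le> prob {\<omega> \<in> space M. \<exists>k\<in>I. f \<omega> = ereal (real k)} + prob (space M - ?F)"
      using ev by (intro measure_Un_le) auto
    also have "\<dots> = (\<Sum>k\<in>I. a k) + (1 - (\<Sum>k<K. a k))"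
      using prob_compl[OF ev(2)] by (simp add: mu I(1))
    finally show "measure (distr M borel f) G \<le> (\<Sum>k\<in>I. a k) + (1 - (\<Sum>k<K. a k))" by (simp add: m)
  qed
  have split_nu: "(\<Sum>k\<in>I. b k) \<le> measure (Geo \<sigma>) G"
    "measure (Geo \<sigma>) G \<le> (\<Sum>k\<in>I. b k) + (1 - (\<Sum>k<K. b k))"
  proof -
    let ?g = "measure_pmf.prob (geometric_pmf \<sigma>)"
    let ?G = "(\<lambda>k. ereal (real k)) -` G"
    have m: "measure (Geo \<sigma>) G = ?g ?G" using G by (simp add: Geo_def measure_distr)
    have "?g I \<le> ?g ?G" by (intro measure_pmf.finite_measure_mono) (auto simp: I_def)
    then show "(\<Sum>k\<in>I. b k) \<le> measure (Geo \<sigma>) G" by (simp add: m nu I(1))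
    have "?g ?G \<le> ?g (I \<union> (UNIV - {..<K}))" by (intro measure_pmf.finite_measure_mono) (auto simp: I_def)
    also have "\<dots> \<le> ?g I + ?g (UNIV - {..<K})" by (intro measure_Un_le) auto
    also have "\<dots> = (\<Sum>k\<in>I. b k) + (1 - (\<Sum>k<K. b k))"
      using measure_pmf.prob_compl[of "{..<K}" "geometric_pmf \<sigma>"] by (simp add: nu I(1))
    finally show "measure (Geo \<sigma>) G \<le> (\<Sum>k\<in>I. b k) + (1 - (\<Sum>k<K. b k))" by (simp add: m)
  qed
  have "\<bar>(\<Sum>k\<in>I. a k) - (\<Sum>k\<in>I. b k)\<bar> \<le> d" unfolding d_def by (rule abs_sum_diff_split[OF I(2)])
  moreover have "\<bar>(\<Sum>k<K. a k) - (\<Sum>k<K. b k)\<bar> \<le> d" unfolding d_def by (rule abs_sum_diff_split) simp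
  moreover have "(\<Sum>k<K. b k) = 1 - (1 - \<sigma>) ^ K" unfolding b_def by (rule geometric_partial_mass[OF \<sigma>])
  ultimately show ?thesis
    using split_mu split_nu unfolding a_def[symmetric] b_def[symmetric] d_def[symmetric] by linarith
qed

text \<open>
  Convergence of the atoms suffices, because parameters bounded away from 0 make the geometric
  distributions uniformly tight.
\<close>

lemma tv_dist_Geo_tendsto:
  fixes f :: "nat \<Rightarrow> 'a \<Rightarrow> ereal"
  assumes "prob_space M" and c: "0 < c"
    and ev: "\<forall>\<^sub>F N in sequentially. f N \<in> borel_measurable M \<and> c \<le> \<sigma> N \<and> \<sigma> N \<le> 1"
    and lim: "\<And>k. (\<lambda>N. measure M {\<omega> \<in> space M. f N \<omega> = ereal (real k)} - \<sigma> N * (1 - \<sigma> N) ^ k) \<longlonglongrightarrow> 0"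
  shows "(\<lambda>N. tv_dist (distr M borel (f N)) (Geo (\<sigma> N))) \<longlonglongrightarrow> 0"
proof (rule tendstoI)
  interpret prob_space M by fact
  fix \<epsilon> :: real assume \<epsilon>: "0 < \<epsilon>"
  let ?s = "\<lambda>K N. \<Sum>k<K. \<bar>prob {\<omega> \<in> space M. f N \<omega> = ereal (real k)} - \<sigma> N * (1 - \<sigma> N) ^ k\<bar>"
  have c1: "c \<le> 1" using eventually_happens'[OF _ ev] by fastforce
  obtain K where K: "(1 - c) ^ K < \<epsilon> / 2"
    using real_arch_pow_inv[of "\<epsilon> / 2" "1 - c"] c \<epsilon> by auto
  have "?s K \<longlonglongrightarrow> (\<Sum>k<K. \<bar>0\<bar>)" by (intro tendsto_sum tendsto_rabs lim)
  then have "\<forall>\<^sub>F N in sequentially. ?s K N < \<epsilon> / 8"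
    using \<epsilon> by (intro order_tendstoD(2)) auto
  with ev show "\<forall>\<^sub>F N in sequentially. dist (tv_dist (distr M borel (f N)) (Geo (\<sigma> N))) 0 < \<epsilon>"
  proof eventually_elim
    case (elim N)
    let ?d = "\<lambda>G. \<bar>measure (distr M borel (f N)) G - measure (Geo (\<sigma> N)) G\<bar>"
    have "(1 - \<sigma> N) ^ K \<le> (1 - c) ^ K" using elim by (intro power_mono) auto
    then have bound: "?d G \<le> 3 * \<epsilon> / 4" if "G \<in> sets borel" for G
      using diff_measure_Geo_le[of "f N" "\<sigma> N" G K] elim that c K \<epsilon> by (simp add: field_simps)
    have "tv_dist (distr M borel (f N)) (Geo (\<sigma> N)) \<le> 3 * \<epsilon> / 4"
      unfolding tv_dist_def by (rule cSUP_least) (use bound in \<open>auto intro: sets.empty_sets\<close>)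
    moreover have "0 \<le> tv_dist (distr M borel (f N)) (Geo (\<sigma> N))"
      unfolding tv_dist_def
      by (rule cSUP_upper2[where x = "{}"]) (use bound in \<open>auto intro!: bdd_aboveI2[where M = "3 * \<epsilon> / 4"]\<close>)
    ultimately show ?case using \<epsilon> by simp
  qed
qed

section \<open>Joint visits of a stationary process\<close>

definition symbol_of :: "real set \<Rightarrow> real set \<Rightarrow> real \<Rightarrow> symbol" where
  "symbol_of A B x = (if x \<in> A then Hazard else if x \<in> B then Hit else Blank)"

lemma stationary_distr:
  assumes "stationary_process M \<xi>" and B: "B \<in> sets borel"
  shows "measure M {\<omega> \<in> space M. \<xi> s \<omega> \<in> B} = measure M {\<omega> \<in> space M. \<xi> 0 \<omega> \<in> B}"
proof -
  let ?P = "Pi\<^sub>M UNIV (\<lambda>_. borel) :: (nat \<Rightarrow> real) measure"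
  have [measurable]: "\<xi> n \<in> borel_measurable M" for n
    using assms by (simp add: stationary_process_def)
  note B [measurable]
  let ?G = "{x \<in> space ?P. x 0 \<in> B}"
  have G: "?G \<in> sets ?P" by measurable
  have "measure (distr M ?P (\<lambda>\<omega> n. \<xi> (n + k) \<omega>)) ?G = measure M {\<omega> \<in> space M. \<xi> k \<omega> \<in> B}" for k
  proof -
    have "(\<lambda>\<omega> n. \<xi> (n + k) \<omega>) \<in> measurable M ?P" by (rule measurable_PiM_single') auto
    from measure_distr[OF this G] show ?thesis
      by (simp add: space_PiM vimage_def Int_def conj_commute)
  qed
  from this[of s] this[of 0] show ?thesis
    using assms by (simp add: stationary_process_def)
qed

lemma min_gap_imp_gap:
  assumes "min_gap l q \<longlonglongrightarrow> \<infinity>"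
  obtains n0 where "\<And>n i. n0 \<le> n \<Longrightarrow> i \<in> {1..l - 1} \<Longrightarrow> q i n + L \<le> q (i + 1) n"
proof -
  have "\<forall>\<^sub>F n in sequentially. enat L < min_gap l q n"
    using assms by (rule order_tendstoD) simp
  then obtain n0 where n0: "enat L < min_gap l q n0"
    by (auto simp: eventually_sequentially)
  have "q i n + L \<le> q (i + 1) n" if "n0 \<le> n" "i \<in> {1..l - 1}" for n i
  proof -
    have "min_gap l q n0 \<le> enat (q (i + 1) n - q i n)"
      unfolding min_gap_def using that by (intro INF_lower2[of n] INF_lower2[of i]) auto
    with n0 have "enat L < enat (q (i + 1) n - q i n)" by (rule less_le_trans)
    then show ?thesis by simp
  qed
  then show thesis by (rule that)
qed

text \<open>
  This translates the estimate for marks into joint visits.  Disjointness of \<open>A\<close> and \<open>B\<close> makes the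
  coding by symbols faithful: a time is never both a hazard and a hit.
\<close>

lemma stopped_joint_visits:
  fixes M :: "'a measure" and \<xi> :: "nat \<Rightarrow> 'a \<Rightarrow> real" and A B :: "real set" and c :: real
    and l :: nat and q :: "nat \<Rightarrow> nat \<Rightarrow> nat"
  defines "Q \<equiv> measure (distr M borel (\<xi> 0))"
  defines "S \<equiv> \<lambda>\<omega>. partial_sum (joint_visit \<xi> l q B) (hazard_time (joint_visit \<xi> l q A) \<omega>) \<omega>"
  defines "\<rho> \<equiv> Q A ^ l / (Q B ^ l + Q A ^ l)"
  assumes M: "prob_space M" and stat: "stationary_process M \<xi>"
    and l: "l \<ge> 1"
    and mono: "\<And>i. i \<in> {1..l} \<Longrightarrow> strict_mono (q i)"
    and incr: "\<And>i n. i \<in> {1..l - 1} \<Longrightarrow> q i n < q (i + 1) n"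
    and AB: "A \<in> sets borel" "B \<in> sets borel" "A \<inter> B = {}"
    and pos: "0 < Q A" "0 < Q B" and c: "Q B ^ l \<le> c * Q A ^ l"
  shows stopped_joint_visits_measurable: "S \<in> borel_measurable M"
    and stopped_joint_visits_bound:
      "psi_coeff M \<xi> L \<le> ennreal e \<Longrightarrow> 0 \<le> e \<Longrightarrow> e \<le> 1/2 \<Longrightarrow> L \<ge> 1 \<Longrightarrow>
       psi_coeff M \<xi> 1 \<le> ennreal D \<Longrightarrow> 0 \<le> D \<Longrightarrow>
       (\<And>i n. n \<ge> n0 \<Longrightarrow> i \<in> {1..l - 1} \<Longrightarrow> q i n + L \<le> q (i + 1) n) \<Longrightarrow> 0 < K \<Longrightarrow>
       \<eta> = real n0 * (Q A + Q B) + (K + 1) * (1 + c) * ((1 + 8 * e) ^ l - 1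
         + real (l * l * (2 * L)) * (((1 + D) ^ (l + 1) + 1) * (Q A + Q B))) \<Longrightarrow>
       \<bar>measure M {\<omega> \<in> space M. S \<omega> = ereal (real k)} - \<rho> * (1 - \<rho>) ^ k\<bar>
         \<le> (real k + 2) * (3 * \<eta> + (1 + \<eta>) / K)"
proof -
  interpret prob_space M by fact
  have \<xi>: "\<xi> n \<in> borel_measurable M" for n
    using stat by (simp add: stationary_process_def)
  let ?h = "symbol_of A B"
  have h_iff: "?h x = Hazard \<longleftrightarrow> x \<in> A" "?h x = Hit \<longleftrightarrow> x \<in> B" for x
    using AB(3) by (auto simp: symbol_of_def)
  have h_vimage: "?h -` {Hazard} = A" "?h -` {Hit} = B" "?h -` {Blank} = - A - B"
    using AB(3) by (auto simp: symbol_of_def split: if_splits)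
  have h: "?h -` {c} \<in> sets borel" for c
    using AB by (cases c) (auto simp: h_vimage)
  interpret symbolic_array M \<xi> ?h l q
  proof unfold_locales
    show "prob {\<omega> \<in> space M. ?h (\<xi> s \<omega>) = c} = prob {\<omega> \<in> space M. ?h (\<xi> 0 \<omega>) = c}" for s c
      using stationary_distr[OF stat h[of c], of s] by (simp add: vimage_def)
  qed (use \<xi> h l mono incr in auto)
  have freq: "freq Hazard = Q A" "freq Hit = Q B"
  proof -
    have "Q X = prob {\<omega> \<in> space M. \<xi> 0 \<omega> \<in> X}" if "X \<in> sets borel" for X
      unfolding Q_def using that \<xi> by (simp add: measure_distr vimage_def Int_def conj_commute)
    then show "freq Hazard = Q A" "freq Hit = Q B"
      using AB by (simp_all add: freq_def w_def h_iff)
  qed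
  have visit: "joint_visit \<xi> l q X n \<omega> = of_bool (Y n \<omega> = s)"
    if "\<And>x. x \<in> X \<longleftrightarrow> ?h x = s" "s \<noteq> Blank" for X s n \<omega>
  proof -
    have "joint_visit \<xi> l q X n \<omega> = (\<Prod>i = 1..l. of_bool (w (q i n) \<omega> = s))"
      by (simp add: joint_visit_def indicator_def that(1) w_def)
    also have "\<dots> = of_bool (\<forall>i\<in>{1..l}. w (q i n) \<omega> = s)"
    proof (cases "\<forall>i\<in>{1..l}. w (q i n) \<omega> = s")
      case False
      then obtain i where "i \<in> {1..l}" "w (q i n) \<omega> \<noteq> s" by blast
      then have "(\<Prod>i = 1..l. of_bool (w (q i n) \<omega> = s) :: real) = 0" by (intro prod_zero) auto
      with False show ?thesis by simp
    qed simp
    also have "\<dots> = of_bool (Y n \<omega> = s)"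
      by (simp add: Y_def mark_iff[OF that(2)] sites_def)
    finally show ?thesis .
  qed
  have "joint_visit \<xi> l q A = (\<lambda>n \<omega>. of_bool (Y n \<omega> = Hazard))"
    by (intro ext visit) (auto simp: h_iff)
  moreover have "joint_visit \<xi> l q B = (\<lambda>n \<omega>. of_bool (Y n \<omega> = Hit))"
    by (intro ext visit) (auto simp: h_iff)
  ultimately have S: "S = stopped_count"
    unfolding S_def stopped_count_def[abs_def] by simp
  show "S \<in> borel_measurable M" unfolding S by (rule measurable_stopped_count)
  assume prem: "psi_coeff M \<xi> L \<le> ennreal e" "0 \<le> e" "e \<le> 1/2" "L \<ge> 1"
       "psi_coeff M \<xi> 1 \<le> ennreal D" "0 \<le> D"
       "\<And>i n. n \<ge> n0 \<Longrightarrow> i \<in> {1..l - 1} \<Longrightarrow> q i n + L \<le> q (i + 1) n" "0 < K"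
     and \<eta>: "\<eta> = real n0 * (Q A + Q B) + (K + 1) * (1 + c) * ((1 + 8 * e) ^ l - 1
         + real (l * l * (2 * L)) * (((1 + D) ^ (l + 1) + 1) * (Q A + Q B)))"
  show "\<bar>prob {\<omega> \<in> space M. S \<omega> = ereal (real k)} - \<rho> * (1 - \<rho>) ^ k\<bar>
         \<le> (real k + 2) * (3 * \<eta> + (1 + \<eta>) / K)"
    using prob_stopped_count_bound[OF prem(1-7) _ _ _ prem(8), where B = c and k = k] pos c
    unfolding S freq \<rho>_def \<eta> by (simp only: add.commute[of "Q B ^ l"])
qed

lemma small_decoupling_error:
  fixes a \<eta> :: real
  assumes "0 < \<eta>"
  obtains e where "0 < e" "e \<le> 1/2" "a * ((1 + 8 * e) ^ l - 1) < \<eta>"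
proof -
  have "(\<lambda>j. a * ((1 + 8 * inverse (real (Suc j))) ^ l - 1)) \<longlonglongrightarrow> a * ((1 + 8 * 0) ^ l - 1)"
    by (intro tendsto_intros LIMSEQ_inverse_real_of_nat)
  then have "\<forall>\<^sub>F j in sequentially. a * ((1 + 8 * inverse (real (Suc j))) ^ l - 1) < \<eta>"
    by (rule order_tendstoD) (use assms in simp)
  moreover have "\<forall>\<^sub>F j in sequentially. inverse (real (Suc j)) < 1/2"
    by (rule order_tendstoD[OF LIMSEQ_inverse_real_of_nat]) simp
  ultimately have "\<forall>\<^sub>F j in sequentially. a * ((1 + 8 * inverse (real (Suc j))) ^ l - 1) < \<eta>
      \<and> inverse (real (Suc j)) < 1/2"
    by (rule eventually_conj)
  then obtain j where "a * ((1 + 8 * inverse (real (Suc j))) ^ l - 1) < \<eta>" "inverse (real (Suc j)) < 1/2"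
    using eventually_happens'[OF sequentially_bot] by blast
  then show thesis by (intro that[of "inverse (real (Suc j))"]) auto
qed

theorem corollary2p2:
  fixes M :: "'a measure" and \<xi> :: "nat \<Rightarrow> 'a \<Rightarrow> real"
    and l :: nat and q :: "nat \<Rightarrow> nat \<Rightarrow> nat"
    and \<Gamma> \<Delta> :: "nat \<Rightarrow> real set" and C :: real
  defines "Q \<equiv> measure (distr M borel (\<xi> 0))"
  defines "S \<equiv> \<lambda>N \<omega>. partial_sum (joint_visit \<xi> l q (\<Delta> N))
                        (hazard_time (joint_visit \<xi> l q (\<Gamma> N)) \<omega>) \<omega>"
  defines "\<rho> \<equiv> \<lambda>N. Q (\<Gamma> N) ^ l / (Q (\<Delta> N) ^ l + Q (\<Gamma> N) ^ l)"
  assumes "prob_space M" and "complete_measure M"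
    and "stationary_process M \<xi>" and "psi_mixing M \<xi>"
    and "l \<ge> 1"
    and "\<And>i. i \<in> {1..l} \<Longrightarrow> strict_mono (q i)"
    and "\<And>i n. i \<in> {1..l - 1} \<Longrightarrow> q i n < q (i + 1) n"
    and "min_gap l q \<longlonglongrightarrow> \<infinity>"
    and "\<And>N. N \<ge> 1 \<Longrightarrow> \<Gamma> N \<in> sets borel" and "\<And>N. N \<ge> 1 \<Longrightarrow> \<Delta> N \<in> sets borel"
    and "\<And>N. N \<ge> 1 \<Longrightarrow> \<Gamma> N \<inter> \<Delta> N = {}"
    and "(\<lambda>N. Q (\<Gamma> N)) \<longlonglongrightarrow> 0" and "(\<lambda>N. Q (\<Delta> N)) \<longlonglongrightarrow> 0"
    and "0 < inverse C"
    and "\<And>N. N \<ge> 1 \<Longrightarrow> inverse C \<le> Q (\<Gamma> N) / Q (\<Delta> N)"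
    and "\<And>N. N \<ge> 1 \<Longrightarrow> Q (\<Gamma> N) / Q (\<Delta> N) \<le> C"
  shows "(\<lambda>N. tv_dist (distr M borel (S N)) (Geo (\<rho> N))) \<longlonglongrightarrow> 0 \<and>
         (\<forall>lam. (\<lambda>N. Q (\<Delta> N) / Q (\<Gamma> N)) \<longlonglongrightarrow> lam \<longrightarrow>
            (\<lambda>N. tv_dist (distr M borel (S N)) (Geo (inverse (1 + lam ^ l)))) \<longlonglongrightarrow> 0)"
proof -
  interpret prob_space M by fact
  have C: "0 < C" using assms(17) by simp
  have Q_pos: "0 < Q (\<Gamma> N)" "0 < Q (\<Delta> N)" if "N \<ge> 1" for N
  proof -
    have "0 < Q (\<Gamma> N) / Q (\<Delta> N)" using assms(17) assms(18)[OF that] by linarith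
    then show "0 < Q (\<Gamma> N)" "0 < Q (\<Delta> N)"
      using measure_nonneg[of "distr M borel (\<xi> 0)"] by (auto simp: zero_less_divide_iff Q_def not_less)
  qed
  have \<Delta>_le: "Q (\<Delta> N) ^ l \<le> C ^ l * Q (\<Gamma> N) ^ l" if "N \<ge> 1" for N
  proof -
    have "Q (\<Delta> N) \<le> C * Q (\<Gamma> N)" using assms(18)[OF that] Q_pos[OF that] C by (simp add: field_simps)
    then show ?thesis using Q_pos[OF that] by (metis less_imp_le power_mono power_mult_distrib)
  qed
  have S_meas: "S N \<in> borel_measurable M" if "N \<ge> 1" for N
    unfolding S_def
    by (rule stopped_joint_visits_measurable[where c = "C ^ l"])
       (use assms that Q_pos[OF that] \<Delta>_le[OF that] in \<open>auto simp: Q_def\<close>)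
  obtain D where D: "0 \<le> D" "psi_coeff M \<xi> 1 \<le> ennreal D"
    using assms(7) by (cases "psi_coeff M \<xi> 1") (auto simp: psi_mixing_def)
  have main: "(\<lambda>N. prob {\<omega> \<in> space M. S N \<omega> = ereal (real k)} - \<rho> N * (1 - \<rho> N) ^ k) \<longlonglongrightarrow> 0" for k
  proof (rule tendstoI)
    fix \<epsilon> :: real assume \<epsilon>: "0 < \<epsilon>"
    define m where "m = real k + 2"
    \<comment> \<open>Survival until the horizon accounts for half of \<open>\<epsilon>\<close>, the decoupling errors for a quarter.\<close>
    define K where "K = 4 * m / \<epsilon> + 1"
    define \<eta>0 where "\<eta>0 = min 1 (\<epsilon> / (12 * m))"
    have m: "0 < m" by (simp add: m_def)
    have K: "0 < K" "m * 2 / K < \<epsilon> / 2"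
    proof -
      show "0 < K" using m \<epsilon> by (auto simp: K_def intro: add_pos_pos)
      have "4 * m / \<epsilon> < K" by (simp add: K_def)
      with \<open>0 < K\<close> \<epsilon> show "m * 2 / K < \<epsilon> / 2" by (simp add: field_simps)
    qed
    have \<eta>0: "0 < \<eta>0" "\<eta>0 \<le> 1" "3 * m * \<eta>0 \<le> \<epsilon> / 4"
    proof -
      show "0 < \<eta>0" "\<eta>0 \<le> 1" using m \<epsilon> by (auto simp: \<eta>0_def)
      have "\<eta>0 \<le> \<epsilon> / (12 * m)" by (simp add: \<eta>0_def)
      with m show "3 * m * \<eta>0 \<le> \<epsilon> / 4" by (simp add: field_simps)
    qed
    \<comment> \<open>Order of choice: the error \<open>e\<close> in terms of \<open>K\<close>, then the distance \<open>L\<close> and the initial segment \<open>n0\<close>, and last \<open>N\<close>.\<close>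
    obtain e where e: "0 < e" "e \<le> 1/2" "(K + 1) * (1 + C ^ l) * ((1 + 8 * e) ^ l - 1) < \<eta>0"
      using small_decoupling_error[OF \<eta>0(1)] by blast
    have "\<forall>\<^sub>F L in sequentially. psi_coeff M \<xi> L < ennreal e"
      using assms(7) e(1) by (intro order_tendstoD(2)[of _ 0]) (auto simp: psi_mixing_def)
    with eventually_ge_at_top[of 1] have "\<forall>\<^sub>F L in sequentially. 1 \<le> L \<and> psi_coeff M \<xi> L < ennreal e"
      by (rule eventually_conj)
    then obtain L where "1 \<le> L" "psi_coeff M \<xi> L < ennreal e"
      using eventually_happens'[OF sequentially_bot] by blast
    then have L: "1 \<le> L" "psi_coeff M \<xi> L \<le> ennreal e" by simp_all
    obtain n0 where n0: "\<And>n i. n0 \<le> n \<Longrightarrow> i \<in> {1..l - 1} \<Longrightarrow> q i n + L \<le> q (i + 1) n"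
      using min_gap_imp_gap[OF assms(11), of L] by blast
    define \<eta> where "\<eta> N = real n0 * (Q (\<Gamma> N) + Q (\<Delta> N)) + (K + 1) * (1 + C ^ l) * ((1 + 8 * e) ^ l - 1
         + real (l * l * (2 * L)) * (((1 + D) ^ (l + 1) + 1) * (Q (\<Gamma> N) + Q (\<Delta> N))))" for N
    have "\<eta> \<longlonglongrightarrow> real n0 * (0 + 0) + (K + 1) * (1 + C ^ l) * ((1 + 8 * e) ^ l - 1
         + real (l * l * (2 * L)) * (((1 + D) ^ (l + 1) + 1) * (0 + 0)))"
      unfolding \<eta>_def[abs_def] by (intro tendsto_intros assms(15,16))
    then have "\<forall>\<^sub>F N in sequentially. \<eta> N < \<eta>0"
      by (rule order_tendstoD) (use e(3) in simp)
    with eventually_ge_at_top[of 1]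
    show "\<forall>\<^sub>F N in sequentially.
        dist (prob {\<omega> \<in> space M. S N \<omega> = ereal (real k)} - \<rho> N * (1 - \<rho> N) ^ k) 0 < \<epsilon>"
    proof eventually_elim
      case (elim N)
      have "\<bar>prob {\<omega> \<in> space M. S N \<omega> = ereal (real k)} - \<rho> N * (1 - \<rho> N) ^ k\<bar>
          \<le> m * (3 * \<eta> N + (1 + \<eta> N) / K)"
        unfolding S_def \<rho>_def Q_def m_def
      proof (rule stopped_joint_visits_bound[where M = M and \<xi> = \<xi> and l = l and q = q
            and A = "\<Gamma> N" and B = "\<Delta> N" and c = "C ^ l" and L = L and e = e and D = D
            and ?n0.0 = n0 and K = K and k = k and \<eta> = "\<eta> N"])
        show "0 < measure (distr M borel (\<xi> 0)) (\<Gamma> N)" "0 < measure (distr M borel (\<xi> 0)) (\<Delta> N)"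
          "measure (distr M borel (\<xi> 0)) (\<Delta> N) ^ l
            \<le> C ^ l * measure (distr M borel (\<xi> 0)) (\<Gamma> N) ^ l"
          using Q_pos[OF elim(1)] \<Delta>_le[OF elim(1)] by (simp_all only: Q_def)
        show "\<eta> N = real n0 * (measure (distr M borel (\<xi> 0)) (\<Gamma> N) + measure (distr M borel (\<xi> 0)) (\<Delta> N))
           + (K + 1) * (1 + C ^ l) * ((1 + 8 * e) ^ l - 1 + real (l * l * (2 * L))
             * (((1 + D) ^ (l + 1) + 1)
               * (measure (distr M borel (\<xi> 0)) (\<Gamma> N) + measure (distr M borel (\<xi> 0)) (\<Delta> N))))"
          by (simp only: \<eta>_def Q_def)
      qed (rule assms(4,6,8) assms(9,10) assms(12-14) elim(1) L e(2) less_imp_le[OF e(1)] D n0 K(1)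
          | assumption)+
      also have "\<dots> \<le> m * (3 * \<eta>0 + (1 + 1) / K)"
        using elim(2) \<eta>0 m K by (intro mult_left_mono add_mono divide_right_mono) auto
      also have "\<dots> = 3 * m * \<eta>0 + m * 2 / K" by (simp add: algebra_simps)
      also have "\<dots> < \<epsilon>" using \<eta>0(3) K(2) \<epsilon> by linarith
      finally show ?case by simp
    qed
  qed
  have \<rho>_bounds: "1 / (1 + C ^ l) \<le> \<rho> N \<and> \<rho> N \<le> 1" if "N \<ge> 1" for N
  proof -
    have pos: "0 < Q (\<Gamma> N) ^ l" "0 < Q (\<Delta> N) ^ l" "0 < C ^ l" using Q_pos[OF that] C by auto
    have "(Q (\<Delta> N) ^ l + Q (\<Gamma> N) ^ l) \<le> Q (\<Gamma> N) ^ l * (1 + C ^ l)"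
      using \<Delta>_le[OF that] by (simp add: algebra_simps)
    with pos show ?thesis unfolding \<rho>_def by (auto simp: field_simps add_pos_pos)
  qed
  have part1: "(\<lambda>N. tv_dist (distr M borel (S N)) (Geo (\<rho> N))) \<longlonglongrightarrow> 0"
  proof (rule tv_dist_Geo_tendsto[OF assms(4) _ _ main])
    show "0 < 1 / (1 + C ^ l)" using C by (simp add: add_pos_pos)
    show "\<forall>\<^sub>F N in sequentially. S N \<in> borel_measurable M \<and> 1 / (1 + C ^ l) \<le> \<rho> N \<and> \<rho> N \<le> 1"
      using eventually_ge_at_top[of 1] by eventually_elim (use S_meas \<rho>_bounds in auto)
  qed
  moreover have "(\<lambda>N. tv_dist (distr M borel (S N)) (Geo (inverse (1 + lam ^ l)))) \<longlonglongrightarrow> 0"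
    if lam: "(\<lambda>N. Q (\<Delta> N) / Q (\<Gamma> N)) \<longlonglongrightarrow> lam" for lam
  proof -
    define \<sigma> where "\<sigma> = inverse (1 + lam ^ l)"
    have "0 \<le> lam" using lam by (rule LIMSEQ_le_const) (auto simp: Q_def)
    then have one: "1 \<le> 1 + lam ^ l" by simp
    then have \<sigma>: "0 < \<sigma>" "\<sigma> \<le> 1" by (auto simp: \<sigma>_def inverse_le_1_iff)
    have "(\<lambda>N. inverse (1 + (Q (\<Delta> N) / Q (\<Gamma> N)) ^ l)) \<longlonglongrightarrow> \<sigma>"
      unfolding \<sigma>_def using one by (intro tendsto_intros lam) auto
    moreover have "\<forall>\<^sub>F N in sequentially. inverse (1 + (Q (\<Delta> N) / Q (\<Gamma> N)) ^ l) = \<rho> N"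
      using eventually_ge_at_top[of 1]
    proof eventually_elim
      case (elim N)
      have "0 < Q (\<Gamma> N) ^ l" using Q_pos[OF elim] by simp
      then have "1 + Q (\<Delta> N) ^ l / Q (\<Gamma> N) ^ l = (Q (\<Delta> N) ^ l + Q (\<Gamma> N) ^ l) / Q (\<Gamma> N) ^ l"
        using Q_pos(1)[OF elim] by (simp add: add_divide_distrib)
      then show ?case by (simp add: \<rho>_def power_divide)
    qed
    ultimately have "\<rho> \<longlonglongrightarrow> \<sigma>" by (rule Lim_transform_eventually)
    then have "(\<lambda>N. \<rho> N * (1 - \<rho> N) ^ k - \<sigma> * (1 - \<sigma>) ^ k) \<longlonglongrightarrow> \<sigma> * (1 - \<sigma>) ^ k - \<sigma> * (1 - \<sigma>) ^ k" for k
      by (intro tendsto_intros)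
    note diff = this
    have lim: "(\<lambda>N. prob {\<omega> \<in> space M. S N \<omega> = ereal (real k)} - \<sigma> * (1 - \<sigma>) ^ k) \<longlonglongrightarrow> 0" for k
      using tendsto_add[OF main[of k] diff[of k]] by simp
    show ?thesis unfolding \<sigma>_def[symmetric]
    proof (rule tv_dist_Geo_tendsto[OF assms(4) \<sigma>(1) _ lim])
      show "\<forall>\<^sub>F N in sequentially. S N \<in> borel_measurable M \<and> \<sigma> \<le> \<sigma> \<and> \<sigma> \<le> 1"
        using eventually_ge_at_top[of 1] by eventually_elim (use S_meas \<sigma> in auto)
    qed
  qed
  ultimately show ?thesis by blast
qed

end
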